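(* Let $Q\in[\mathcal H_1,\mathcal H_2]$, $\varphi_1:=\arccos(\|Q\|^{-1})>0$ and $\varphi\in[\varphi_1,\pi/2]$. For $K\in[\mathcal H_1,\mathcal H_2]$ put $(K^*Q)_I:=(2i)^{-1}(K^*Q-Q^*K)$ and $$D_{K,Q}:=(I-K^*K\sin^2\varphi-Q^*Q\cos^2\varphi)^{1/2}\ge0 .$$ Then: (i) the following equivalence holds: $$K\in L(Q;\varphi)\iff \sin2\varphi\cdot(K^*Q)_I=D_{K,Q}\,C\,D_{K,Q}\quad\text{for some selfadjoint contraction } C=C^*\in[\mathcal H_1]$$ (the right-hand side including the requirement $I-K^*K\sin^2\varphi-Q^*Q\cos^2\varphi\ge0$, so that $D_{K,Q}$ is defined); (ii) if additionally $\mathrm{ran}\,D_{K,Q}$ is closed, that is $\mathrm{ran}\,D_{K,Q}=\overline{\mathrm{ran}}\,D_{K,Q}$, then, for $K\in L(Q;\varphi)$ and $C$ as in (i), the following implication holds: $$\sigma(C)\subset\{\pm1\}\ \Longrightarrow\ K\in L^e(Q;\varphi).$$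
   Context: $\mathcal H_1,\mathcal H_2$ are separable Hilbert spaces and $[\mathcal H_1,\mathcal H_2]$ denotes the bounded operators from $\mathcal H_1$ to $\mathcal H_2$; $[\mathcal H_1]=[\mathcal H_1,\mathcal H_1]$. $L(Q;\varphi):=\{K\in[\mathcal H_1,\mathcal H_2]:\ \|K\sin\varphi+iQ\cos\varphi\|\le1,\ \|K\sin\varphi-iQ\cos\varphi\|\le1\}$, and $L^e(Q;\varphi)$ is the set of extreme points of this closed convex set. $\sigma(C)$ is the spectrum of $C$.
   Formalization: In (ii), C is additionally required to map ran D_{K,Q} into itself (C acts in ran D_{K,Q}); for arbitrary C as in (i) the implication fails, e.g. for φ=π/3, Q=diag(0,2), K=0, C=[[0,1],[1,0]]. *)

theory Defs
  imports "HOL-Analysis.Analysis"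
begin

section \<open>Complex Hilbert spaces\<close>

text \<open>The complex structure is added on top of the real classes, so that norm, metric, topology,
  convexity and extreme points are those of HOL-Analysis.\<close>

class complex_vector = real_vector +
  fixes scaleC :: "complex \<Rightarrow> 'a \<Rightarrow> 'a" (infixr \<open>*\<^sub>C\<close> 75)
  assumes scaleC_add_right: "a *\<^sub>C (x + y) = a *\<^sub>C x + a *\<^sub>C y"
    and scaleC_add_left: "(a + b) *\<^sub>C x = a *\<^sub>C x + b *\<^sub>C x"
    and scaleC_scaleC: "a *\<^sub>C b *\<^sub>C x = (a * b) *\<^sub>C x"
    and scaleC_of_real: "complex_of_real r *\<^sub>C x = r *\<^sub>R x"

text \<open>The complex inner product is linear in the first and conjugate linear in the second
  argument. Since the real inner product is its real part, it induces the norm.\<close>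

class complex_inner = complex_vector + real_inner +
  fixes cinner :: "'a \<Rightarrow> 'a \<Rightarrow> complex"
  assumes cinner_commute: "cinner x y = cnj (cinner y x)"
    and cinner_add_left: "cinner (x + y) z = cinner x z + cinner y z"
    and cinner_scaleC_left: "cinner (a *\<^sub>C x) y = a * cinner x y"
    and inner_cinner: "inner x y = Re (cinner x y)"

class chilbert_space = complex_inner + complete_space

instantiation complex :: chilbert_space
begin

definition scaleC_complex :: "complex \<Rightarrow> complex \<Rightarrow> complex"
  where "scaleC_complex a x = a * x"

definition cinner_complex :: "complex \<Rightarrow> complex \<Rightarrow> complex"
  where "cinner_complex x y = x * cnj y"

instance
  by standard
    (auto simp: scaleC_complex_def cinner_complex_def inner_complex_def algebra_simps
      scaleR_conv_of_real)

end

lemma scaleC_one [simp]: "1 *\<^sub>C x = (x :: 'a::complex_vector)"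
  using scaleC_of_real[of 1 x] by simp

lemma cinner_self: "cinner x x = complex_of_real ((norm x)\<^sup>2)"
proof (rule complex_eqI)
  show "Re (cinner x x) = Re (complex_of_real ((norm x)\<^sup>2))"
    by (simp add: inner_cinner[symmetric] power2_norm_eq_inner)
  have "Im (cinner x x) = - Im (cinner x x)"
    using arg_cong[OF cinner_commute[of x x], of Im] by simp
  then show "Im (cinner x x) = Im (complex_of_real ((norm x)\<^sup>2))"
    by simp
qed

lemma norm_scaleC [simp]: "norm (a *\<^sub>C x) = norm a * norm (x :: 'a::complex_inner)"
proof -
  have "complex_of_real ((norm (a *\<^sub>C x))\<^sup>2) = a * cinner x (a *\<^sub>C x)"
    by (simp only: cinner_self[symmetric] cinner_scaleC_left)
  also have "\<dots> = (a * cnj a) * cinner x x"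
    by (subst cinner_commute) (simp add: cinner_scaleC_left cinner_self)
  also have "\<dots> = complex_of_real ((norm a)\<^sup>2 * (norm x)\<^sup>2)"
    by (simp only: cinner_self complex_norm_square[symmetric] of_real_mult)
  finally have "(norm (a *\<^sub>C x))\<^sup>2 = (norm a * norm x)\<^sup>2"
    by (simp only: of_real_eq_iff power_mult_distrib)
  then show ?thesis
    by (simp add: power2_eq_iff_nonneg)
qed

lemma bounded_linear_scaleC_right:
  "bounded_linear (\<lambda>x :: 'a::complex_inner. a *\<^sub>C x)"
proof (rule bounded_linear_intro)
  fix r and x :: 'a
  show "a *\<^sub>C r *\<^sub>R x = r *\<^sub>R a *\<^sub>C x"
    by (simp add: scaleC_of_real[symmetric] scaleC_scaleC mult.commute)
  show "norm (a *\<^sub>C x) \<le> norm x * norm a"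
    by simp
qed (simp add: scaleC_add_right)


section \<open>Bounded complex linear operators\<close>

typedef (overloaded) ('a::complex_inner, 'b::complex_inner) cblinfun (\<open>(_ \<Rightarrow>\<^sub>C\<^sub>L /_)\<close> [22, 21] 21) =
  "{f :: 'a \<Rightarrow> 'b. bounded_linear f \<and> (\<forall>a x. f (a *\<^sub>C x) = a *\<^sub>C f x)}"
  morphisms cblinfun_apply Cblinfun
  by (rule exI[of _ "\<lambda>_. 0"])
    (simp add: linear_0[OF bounded_linear.linear[OF bounded_linear_scaleC_right]])

setup_lifting type_definition_cblinfun

notation cblinfun_apply (infixr \<open>*\<^sub>V\<close> 70)

instantiation cblinfun :: (complex_inner, complex_inner) real_normed_vector
begin

lift_definition norm_cblinfun :: "'a \<Rightarrow>\<^sub>C\<^sub>L 'b \<Rightarrow> real" is onorm .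

lift_definition zero_cblinfun :: "'a \<Rightarrow>\<^sub>C\<^sub>L 'b" is "\<lambda>_. 0"
  by (simp add: linear_0[OF bounded_linear.linear[OF bounded_linear_scaleC_right]])

lift_definition uminus_cblinfun :: "'a \<Rightarrow>\<^sub>C\<^sub>L 'b \<Rightarrow> 'a \<Rightarrow>\<^sub>C\<^sub>L 'b" is "\<lambda>f x. - f x"
  by (auto intro: bounded_linear_minus
      simp: linear_neg[OF bounded_linear.linear[OF bounded_linear_scaleC_right]])

lift_definition plus_cblinfun :: "'a \<Rightarrow>\<^sub>C\<^sub>L 'b \<Rightarrow> 'a \<Rightarrow>\<^sub>C\<^sub>L 'b \<Rightarrow> 'a \<Rightarrow>\<^sub>C\<^sub>L 'b" is "\<lambda>f g x. f x + g x"
  by (auto intro: bounded_linear_add simp: scaleC_add_right)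

lift_definition minus_cblinfun :: "'a \<Rightarrow>\<^sub>C\<^sub>L 'b \<Rightarrow> 'a \<Rightarrow>\<^sub>C\<^sub>L 'b \<Rightarrow> 'a \<Rightarrow>\<^sub>C\<^sub>L 'b" is "\<lambda>f g x. f x - g x"
  by (auto intro: bounded_linear_sub
      simp: linear_diff[OF bounded_linear.linear[OF bounded_linear_scaleC_right]])

lift_definition scaleR_cblinfun :: "real \<Rightarrow> 'a \<Rightarrow>\<^sub>C\<^sub>L 'b \<Rightarrow> 'a \<Rightarrow>\<^sub>C\<^sub>L 'b" is "\<lambda>r f x. r *\<^sub>R f x"
  by (auto intro: bounded_linear_const_scaleR
      simp: linear_scale[OF bounded_linear.linear[OF bounded_linear_scaleC_right]])

definition dist_cblinfun :: "'a \<Rightarrow>\<^sub>C\<^sub>L 'b \<Rightarrow> 'a \<Rightarrow>\<^sub>C\<^sub>L 'b \<Rightarrow> real"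
  where "dist_cblinfun A B = norm (A - B)"

definition sgn_cblinfun :: "'a \<Rightarrow>\<^sub>C\<^sub>L 'b \<Rightarrow> 'a \<Rightarrow>\<^sub>C\<^sub>L 'b"
  where "sgn_cblinfun A = inverse (norm A) *\<^sub>R A"

definition uniformity_cblinfun :: "(('a \<Rightarrow>\<^sub>C\<^sub>L 'b) \<times> ('a \<Rightarrow>\<^sub>C\<^sub>L 'b)) filter"
  where "uniformity_cblinfun = (INF e\<in>{0<..}. principal {(A, B). dist A B < e})"

definition open_cblinfun :: "('a \<Rightarrow>\<^sub>C\<^sub>L 'b) set \<Rightarrow> bool"
  where "open_cblinfun S \<longleftrightarrow> (\<forall>A\<in>S. \<forall>\<^sub>F (A', B) in uniformity. A' = A \<longrightarrow> B \<in> S)"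

instance
proof
  fix A B :: "'a \<Rightarrow>\<^sub>C\<^sub>L 'b" and r :: real
  show "norm A = 0 \<longleftrightarrow> A = 0"
    by transfer (auto simp: onorm_eq_0 fun_eq_iff)
  show "norm (A + B) \<le> norm A + norm B"
    by transfer (auto intro: onorm_triangle)
  show "norm (r *\<^sub>R A) = \<bar>r\<bar> * norm A"
    by transfer (auto intro: onorm_scaleR)
qed (simp_all add: dist_cblinfun_def sgn_cblinfun_def uniformity_cblinfun_def open_cblinfun_def,
    (transfer, force simp: algebra_simps)+)

end

instantiation cblinfun :: (complex_inner, complex_inner) complex_vector
begin

lift_definition scaleC_cblinfun :: "complex \<Rightarrow> 'a \<Rightarrow>\<^sub>C\<^sub>L 'b \<Rightarrow> 'a \<Rightarrow>\<^sub>C\<^sub>L 'b" is "\<lambda>a f x. a *\<^sub>C f x"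
  by (auto intro: bounded_linear_compose[OF bounded_linear_scaleC_right]
      simp: scaleC_scaleC mult.commute)

instance
  by standard
    (transfer, simp add: scaleC_add_right scaleC_add_left scaleC_scaleC scaleC_of_real)+

end

lift_definition id_cblinfun :: "'a::complex_inner \<Rightarrow>\<^sub>C\<^sub>L 'a" is "\<lambda>x. x"
  by simp

lift_definition cblinfun_compose ::
    "'b::complex_inner \<Rightarrow>\<^sub>C\<^sub>L 'c::complex_inner \<Rightarrow> 'a::complex_inner \<Rightarrow>\<^sub>C\<^sub>L 'b \<Rightarrow> 'a \<Rightarrow>\<^sub>C\<^sub>L 'c"
    (infixl \<open>o\<^sub>C\<close> 67) is "\<lambda>f g x. f (g x)"
  by (auto intro: bounded_linear_compose)

text \<open>The adjoint exists and is unique on Hilbert spaces (Riesz).\<close>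

definition adj :: "'a::chilbert_space \<Rightarrow>\<^sub>C\<^sub>L 'b::chilbert_space \<Rightarrow> 'b \<Rightarrow>\<^sub>C\<^sub>L 'a"
  where "adj A = (THE B. \<forall>x y. cinner (A *\<^sub>V x) y = cinner x (B *\<^sub>V y))"

definition selfadjoint :: "'a::chilbert_space \<Rightarrow>\<^sub>C\<^sub>L 'a \<Rightarrow> bool"
  where "selfadjoint A \<longleftrightarrow> adj A = A"

definition nonneg_op :: "'a::complex_inner \<Rightarrow>\<^sub>C\<^sub>L 'a \<Rightarrow> bool"
  where "nonneg_op A \<longleftrightarrow> (\<forall>x. Im (cinner (A *\<^sub>V x) x) = 0 \<and> 0 \<le> Re (cinner (A *\<^sub>V x) x))"

text \<open>The unique nonnegative square root; meaningful only for \<open>nonneg_op A\<close>.\<close>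

definition sqrt_op :: "'a::chilbert_space \<Rightarrow>\<^sub>C\<^sub>L 'a \<Rightarrow> 'a \<Rightarrow>\<^sub>C\<^sub>L 'a"
  where "sqrt_op A = (THE B. nonneg_op B \<and> B o\<^sub>C B = A)"

definition invertible_op :: "'a::complex_inner \<Rightarrow>\<^sub>C\<^sub>L 'a \<Rightarrow> bool"
  where "invertible_op A \<longleftrightarrow> (\<exists>B. A o\<^sub>C B = id_cblinfun \<and> B o\<^sub>C A = id_cblinfun)"

definition op_spectrum :: "'a::complex_inner \<Rightarrow>\<^sub>C\<^sub>L 'a \<Rightarrow> complex set"
  where "op_spectrum A = {z. \<not> invertible_op (A - z *\<^sub>C id_cblinfun)}"


section \<open>The set \<open>L(Q;\<phi>)\<close> and its extreme points\<close>

definition L_set :: "'a::chilbert_space \<Rightarrow>\<^sub>C\<^sub>L 'b::chilbert_space \<Rightarrow> real \<Rightarrow> ('a \<Rightarrow>\<^sub>C\<^sub>L 'b) set"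
  where "L_set Q \<phi> = {K. norm (sin \<phi> *\<^sub>R K + \<i> *\<^sub>C (cos \<phi> *\<^sub>R Q)) \<le> 1
                        \<and> norm (sin \<phi> *\<^sub>R K - \<i> *\<^sub>C (cos \<phi> *\<^sub>R Q)) \<le> 1}"

definition L_ext :: "'a::chilbert_space \<Rightarrow>\<^sub>C\<^sub>L 'b::chilbert_space \<Rightarrow> real \<Rightarrow> ('a \<Rightarrow>\<^sub>C\<^sub>L 'b) set"
  where "L_ext Q \<phi> = {K. K extreme_point_of L_set Q \<phi>}"

definition im_adj_prod :: "'a::chilbert_space \<Rightarrow>\<^sub>C\<^sub>L 'b::chilbert_space \<Rightarrow> 'a \<Rightarrow>\<^sub>C\<^sub>L 'b \<Rightarrow> 'a \<Rightarrow>\<^sub>C\<^sub>L 'a"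
  where "im_adj_prod K Q = inverse (2 * \<i>) *\<^sub>C (adj K o\<^sub>C Q - adj Q o\<^sub>C K)"

definition defect_sq ::
    "'a::chilbert_space \<Rightarrow>\<^sub>C\<^sub>L 'b::chilbert_space \<Rightarrow> 'a \<Rightarrow>\<^sub>C\<^sub>L 'b \<Rightarrow> real \<Rightarrow> 'a \<Rightarrow>\<^sub>C\<^sub>L 'a"
  where "defect_sq K Q \<phi> =
    id_cblinfun - (sin \<phi>)\<^sup>2 *\<^sub>R (adj K o\<^sub>C K) - (cos \<phi>)\<^sup>2 *\<^sub>R (adj Q o\<^sub>C Q)"

definition defect ::
    "'a::chilbert_space \<Rightarrow>\<^sub>C\<^sub>L 'b::chilbert_space \<Rightarrow> 'a \<Rightarrow>\<^sub>C\<^sub>L 'b \<Rightarrow> real \<Rightarrow> 'a \<Rightarrow>\<^sub>C\<^sub>L 'a"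
  where "defect K Q \<phi> = sqrt_op (defect_sq K Q \<phi>)"

text \<open>The selfadjoint contractions \<open>C\<close> on the domain space with
  \<open>sin 2\<phi> (K*Q)\<^sub>I = D C D\<close>, where \<open>D = defect K Q \<phi>\<close>. Such a \<open>C\<close> is determined
  only up to its compression to the closure of \<open>ran D\<close>.\<close>

definition defect_factor ::
    "'a::chilbert_space \<Rightarrow>\<^sub>C\<^sub>L 'b::chilbert_space \<Rightarrow> 'a \<Rightarrow>\<^sub>C\<^sub>L 'b \<Rightarrow> real \<Rightarrow> 'a \<Rightarrow>\<^sub>C\<^sub>L 'a \<Rightarrow> bool"
  where "defect_factor K Q \<phi> C \<longleftrightarrow> selfadjoint C \<and> norm C \<le> 1 \<and>
    sin (2 * \<phi>) *\<^sub>R im_adj_prod K Q = defect K Q \<phi> o\<^sub>C C o\<^sub>C defect K Q \<phi>"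

end

theory Submission
  imports Defs
begin

text \<open>Put \<open>N = 1 - sin\<^sup>2\<phi> K*K - cos\<^sup>2\<phi> Q*Q\<close>, \<open>D = N\<^sup>1\<^sup>/\<^sup>2\<close> and \<open>T = sin 2\<phi> (K*Q)\<^sub>I\<close>. Then
  \<open>\<parallel>(sin \<phi> K \<plusminus> i cos \<phi> Q) x\<parallel>\<^sup>2 = \<parallel>x\<parallel>\<^sup>2 - \<langle>N x, x\<rangle> \<mp> \<langle>T x, x\<rangle>\<close>, so \<open>K \<in> L(Q;\<phi>)\<close> says that
  \<open>-N \<le> T \<le> N\<close>. Douglas' lemma applied to the square roots of \<open>(N \<plusminus> T) / 2\<close> turns this into
  \<open>T = D C D\<close> with a selfadjoint contraction \<open>C\<close>. If the spectrum of \<open>C\<close> is contained in \<open>{1, -1}\<close>,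
  then \<open>C\<^sup>2 = 1\<close>, and each of the two contractions \<open>sin \<phi> K \<plusminus> i cos \<phi> Q\<close> is isometric on an
  eigenspace of \<open>C\<close> pulled back by \<open>D\<close>; there strict convexity of the norm makes any two
  elements of \<open>L(Q;\<phi>)\<close> with \<open>K\<close> strictly between them coincide.\<close>

section \<open>Riesz representation, adjoints and factorisation\<close>

text \<open>Riesz' theorem by minimising \<open>J x = (norm (D x))^2 - 2 * l x\<close>. A minimiser
  in the domain need not exist, but the images \<open>D (X n)\<close> of a minimising sequence
  converge, and their limit represents \<open>l\<close>. With \<open>D\<close> general this also
  carries the factorisation lemma below.\<close>

lemma riesz_variational:
  fixes D :: "'a::real_vector \<Rightarrow> 'b::{real_inner,complete_space}" and l :: "'a \<Rightarrow> real"
  assumes D: "linear D" and l: "linear l" and bound: "\<And>x. \<bar>l x\<bar> \<le> k * norm (D x)"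
    and k: "0 \<le> k"
  shows "\<exists>y\<in>closure (range D). norm y \<le> k \<and> (\<forall>x. l x = D x \<bullet> y)"
proof -
  define J where "J x = (norm (D x))\<^sup>2 - 2 * l x" for x
  note lin = linear_add[OF D] linear_add[OF l] linear_scale[OF D] linear_scale[OF l]
  \<comment> \<open>Completing the square in \<open>norm (D x)\<close> bounds \<open>J\<close> from
    below.\<close>
  have J_ge: "- k\<^sup>2 \<le> J x" for x
  proof -
    have "2 * l x \<le> 2 * k * norm (D x)" using bound[of x] by auto
    moreover have "0 \<le> (norm (D x) - k)\<^sup>2" by simp
    ultimately show ?thesis unfolding J_def by (simp add: power2_diff algebra_simps)
  qed
  define m where "m = (INF x. J x)"
  have bdd: "bdd_below (range J)" using J_ge by (auto intro!: bdd_belowI)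
  have m_le: "m \<le> J x" for x unfolding m_def by (rule cINF_lower[OF bdd]) simp
  have "\<exists>x. J x < m + inverse (real (Suc n))" for n
  proof -
    have "m < m + inverse (real (Suc n))" by simp
    then show ?thesis unfolding m_def using cINF_less_iff[OF _ bdd] by blast
  qed
  then obtain X where X: "\<And>n. J (X n) < m + inverse (real (Suc n))" by metis
  have JX: "(\<lambda>n. J (X n)) \<longlonglongrightarrow> m"
  proof (rule tendsto_sandwich[OF _ _ tendsto_const])
    show "(\<lambda>n. m + inverse (real (Suc n))) \<longlonglongrightarrow> m"
      using tendsto_add[OF tendsto_const LIMSEQ_inverse_real_of_nat] by simp
  qed (use m_le X less_imp_le in \<open>auto intro!: always_eventually\<close>)
  \<comment> \<open>Parallelogram law, with the value of \<open>J\<close> at the midpoint bounded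
    below by the infimum \<open>m\<close>.\<close>
  have par: "(dist (D x) (D z))\<^sup>2 \<le> 2 * (J x + J z) - 4 * m" for x z
  proof -
    have "(dist (D x) (D z))\<^sup>2 = 2 * (J x + J z) - 4 * J ((1/2) *\<^sub>R (x + z))"
      unfolding J_def lin dist_norm power2_norm_eq_inner
      by (simp add: algebra_simps inner_commute)
    then show ?thesis using m_le[of "(1/2) *\<^sub>R (x + z)"] by linarith
  qed
  have "Cauchy (\<lambda>n. D (X n))"
  proof (rule metric_CauchyI)
    fix e :: real assume "0 < e"
    then have "m < m + e\<^sup>2 / 4" by simp
    then have "eventually (\<lambda>n. J (X n) < m + e\<^sup>2 / 4) sequentially"
      using order_tendstoD(2)[OF JX] by blast
    then obtain M where M: "\<And>n. n \<ge> M \<Longrightarrow> J (X n) < m + e\<^sup>2 / 4"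
      by (auto simp: eventually_sequentially)
    have "dist (D (X i)) (D (X j)) < e" if "i \<ge> M" "j \<ge> M" for i j
    proof -
      have "(dist (D (X i)) (D (X j)))\<^sup>2 < e\<^sup>2"
        using par[of "X i" "X j"] M[OF that(1)] M[OF that(2)] by argo
      then show ?thesis using \<open>0 < e\<close> by (simp add: power_less_imp_less_base)
    qed
    then show "\<exists>M. \<forall>i\<ge>M. \<forall>j\<ge>M. dist (D (X i)) (D (X j)) < e" by blast
  qed
  then obtain y where y: "(\<lambda>n. D (X n)) \<longlonglongrightarrow> y"
    using Cauchy_convergent_iff convergent_def by blast
  have eq: "l x = D x \<bullet> y" for x
  proof -
    define b where "b = D x \<bullet> y - l x"
    \<comment> \<open>First variation in direction \<open>x\<close>: the minimality
      \<open>m \<le> J (X n + t x)\<close> survives the limit in \<open>n\<close>.\<close>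
    have quad: "0 \<le> 2 * t * b + t\<^sup>2 * (norm (D x))\<^sup>2" for t
    proof -
      have "J (X n + t *\<^sub>R x) = J (X n) + 2 * t * (D x \<bullet> D (X n) - l x) + t\<^sup>2 * (norm (D x))\<^sup>2" for n
        unfolding J_def lin power2_norm_eq_inner
        by (simp add: algebra_simps inner_commute power2_eq_square)
      moreover have "(\<lambda>n. J (X n) + 2 * t * (D x \<bullet> D (X n) - l x) + t\<^sup>2 * (norm (D x))\<^sup>2)
          \<longlonglongrightarrow> m + 2 * t * b + t\<^sup>2 * (norm (D x))\<^sup>2"
        unfolding b_def by (intro tendsto_intros JX y)
      ultimately have "m \<le> m + 2 * t * b + t\<^sup>2 * (norm (D x))\<^sup>2"
        using m_le by (metis (no_types, lifting) LIMSEQ_le_const)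
      then show ?thesis by simp
    qed
    have "b = 0"
    proof (rule ccontr)
      assume "b \<noteq> 0"
      \<comment> \<open>The added 1 keeps \<open>N\<close> positive when \<open>D x = 0\<close>; at
        \<open>t = - b / N\<close> the quadratic is then at most \<open>- b^2 / N\<close>.\<close>
      define N where "N = (norm (D x))\<^sup>2 + 1"
      have "N > 0" unfolding N_def by (simp add: add_nonneg_pos)
      have "(- b / N)\<^sup>2 * (norm (D x))\<^sup>2 \<le> (- b / N)\<^sup>2 * N"
        unfolding N_def by (intro mult_left_mono) auto
      also have "\<dots> = b\<^sup>2 / N" using \<open>N > 0\<close> by (simp add: power2_eq_square)
      finally have "0 \<le> 2 * (- b / N) * b + b\<^sup>2 / N" using quad[of "- b / N"] by linarith
      also have "\<dots> = - (b\<^sup>2 / N)" by (simp add: power2_eq_square)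
      finally show False using \<open>b \<noteq> 0\<close> \<open>N > 0\<close> by (simp add: divide_le_0_iff)
    qed
    then show ?thesis unfolding b_def by simp
  qed
  \<comment> \<open>Applying the bound on \<open>l\<close> along \<open>X n\<close> and passing to
    the limit gives \<open>norm y * norm y \<le> k * norm y\<close>.\<close>
  have "(\<lambda>n. D (X n) \<bullet> y) \<longlonglongrightarrow> y \<bullet> y" and "(\<lambda>n. k * norm (D (X n))) \<longlonglongrightarrow> k * norm y"
    by (intro tendsto_intros y)+
  moreover have "D (X n) \<bullet> y \<le> k * norm (D (X n))" for n
    using bound[of "X n"] eq[of "X n"] by linarith
  ultimately have "y \<bullet> y \<le> k * norm y" by (blast intro: LIMSEQ_le)
  then have yy: "norm y * norm y \<le> k * norm y" by (simp add: dot_square_norm power2_eq_square)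
  have "norm y \<le> k"
    using yy k by (cases "y = 0") (simp_all add: mult_le_cancel_right)
  moreover have "y \<in> closure (range D)" 
    unfolding closure_sequential by (intro exI[of _ "\<lambda>n. D (X n)"]) (simp add: y)
  ultimately show ?thesis using eq by blast
qed

section \<open>Sesquilinear algebra of the complex inner product\<close>

lemma cinner_add_right: "cinner x (y + z) = cinner x y + cinner x z"
  by (subst (1 2 3) cinner_commute) (simp add: cinner_add_left)

lemma cinner_scaleC_right: "cinner x (a *\<^sub>C y) = cnj a * cinner x y"
  by (subst (1 2) cinner_commute) (simp add: cinner_scaleC_left)

lemma cinner_scaleR_left: "cinner (r *\<^sub>R x) y = of_real r * cinner x y"
  by (simp add: scaleC_of_real[symmetric] cinner_scaleC_left)

lemma cinner_scaleR_right: "cinner x (r *\<^sub>R y) = of_real r * cinner x y"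
  by (simp add: scaleC_of_real[symmetric] cinner_scaleC_right)

lemma cinner_minus_left: "cinner (- x) y = - cinner x y"
  using cinner_scaleR_left[of "-1" x y] by simp

lemma cinner_minus_right: "cinner x (- y) = - cinner x y"
  using cinner_scaleR_right[of x "-1" y] by simp

lemma cinner_diff_left: "cinner (x - y) z = cinner x z - cinner y z"
  using cinner_add_left[of x "- y" z] by (simp add: cinner_minus_left)

lemma cinner_diff_right: "cinner x (y - z) = cinner x y - cinner x z"
  using cinner_add_right[of x y "- z"] by (simp add: cinner_minus_right)

lemma cinner_zero_left [simp]: "cinner 0 y = 0"
  using cinner_scaleR_left[of 0 0 y] by simp

lemma cinner_zero_right [simp]: "cinner x 0 = 0"
  using cinner_scaleR_right[of x 0 0] by simp

lemmas cinner_simps = cinner_add_left cinner_add_right cinner_diff_left cinner_diff_right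
  cinner_scaleR_left cinner_scaleR_right cinner_scaleC_left cinner_scaleC_right
  cinner_minus_left cinner_minus_right

lemma cinner_eq_inner: "cinner x y = Complex (inner x y) (inner x (\<i> *\<^sub>C y))"
  by (rule complex_eqI) (simp_all add: inner_cinner cinner_scaleC_right)

lemma norm_eq_Re_cinner: "(norm x)\<^sup>2 = Re (cinner x x)"
  by (simp add: cinner_self)

lemma cinner_Re_ext:
  assumes "\<And>z. Re (cinner z x) = Re (cinner z y)"
  shows "x = y"
proof -
  have "Re (cinner (x - y) (x - y)) = 0"
    using assms[of "x - y"] by (simp add: cinner_diff_right)
  then show ?thesis by (simp add: norm_eq_Re_cinner[symmetric])
qed

section \<open>Elementary calculus of bounded operators\<close>

lemma bounded_linear_cblinfun_apply: "bounded_linear (cblinfun_apply A)"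
  using cblinfun_apply[of A] by auto

lemma linear_cblinfun_apply: "linear (cblinfun_apply A)"
  by (rule bounded_linear.linear[OF bounded_linear_cblinfun_apply])

lemma cblinfun_apply_scaleC [simp]: "A *\<^sub>V (a *\<^sub>C x) = a *\<^sub>C (A *\<^sub>V x)"
  using cblinfun_apply[of A] by auto

lemma cblinfun_apply_linear [simp]:
  "A *\<^sub>V (x + y) = A *\<^sub>V x + A *\<^sub>V y"
  "A *\<^sub>V (x - y) = A *\<^sub>V x - A *\<^sub>V y"
  "A *\<^sub>V (- x) = - (A *\<^sub>V x)"
  "A *\<^sub>V (r *\<^sub>R x) = r *\<^sub>R (A *\<^sub>V x)"
  "A *\<^sub>V 0 = 0"
  by (simp_all add: linear_add linear_diff linear_neg linear_scale linear_0 linear_cblinfun_apply)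

declare plus_cblinfun.rep_eq [simp] minus_cblinfun.rep_eq [simp] uminus_cblinfun.rep_eq [simp]
  zero_cblinfun.rep_eq [simp] scaleR_cblinfun.rep_eq [simp] scaleC_cblinfun.rep_eq [simp]
  id_cblinfun.rep_eq [simp] cblinfun_compose.rep_eq [simp]

lemma cblinfun_eqI: "(\<And>x. A *\<^sub>V x = B *\<^sub>V x) \<Longrightarrow> A = B"
  by (simp add: cblinfun_apply_inject[symmetric] fun_eq_iff)

lemma norm_cblinfun_apply_le: "norm (A *\<^sub>V x) \<le> norm A * norm x"
  using onorm[OF bounded_linear_cblinfun_apply] by (simp add: norm_cblinfun.rep_eq)

lemma norm_cblinfun_le: "(\<And>x. norm (A *\<^sub>V x) \<le> k * norm x) \<Longrightarrow> 0 \<le> k \<Longrightarrow> norm A \<le> k"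
  by (simp add: norm_cblinfun.rep_eq onorm_bound)

lemma norm_cblinfun_le_one_iff: "norm A \<le> 1 \<longleftrightarrow> (\<forall>x. norm (A *\<^sub>V x) \<le> norm x)"
proof
  assume "norm A \<le> 1"
  then have "norm A * norm x \<le> norm x" for x
    using mult_right_mono[of "norm A" 1 "norm x"] by simp
  then show "\<forall>x. norm (A *\<^sub>V x) \<le> norm x"
    using norm_cblinfun_apply_le order_trans by blast
qed (auto intro: norm_cblinfun_le)

lemma norm_cblinfun_compose_le: "norm (A o\<^sub>C B) \<le> norm A * norm B"
proof (rule norm_cblinfun_le)
  show "norm ((A o\<^sub>C B) *\<^sub>V x) \<le> norm A * norm B * norm x" for x
    using mult_left_mono[OF norm_cblinfun_apply_le[of B x] norm_ge_zero[of A]]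
      norm_cblinfun_apply_le[of A "B *\<^sub>V x"] by (simp add: mult.assoc)
qed simp

lemma cblinfun_compose_linear_left:
  "(A + B) o\<^sub>C C = A o\<^sub>C C + B o\<^sub>C C"
  "(A - B) o\<^sub>C C = A o\<^sub>C C - B o\<^sub>C C"
  "(r *\<^sub>R A) o\<^sub>C C = r *\<^sub>R (A o\<^sub>C C)"
  by (rule cblinfun_eqI; simp)+

lemma cblinfun_compose_linear_right:
  "C o\<^sub>C (A + B) = C o\<^sub>C A + C o\<^sub>C B"
  "C o\<^sub>C (A - B) = C o\<^sub>C A - C o\<^sub>C B"
  "C o\<^sub>C (r *\<^sub>R A) = r *\<^sub>R (C o\<^sub>C A)"
  by (rule cblinfun_eqI; simp)+

lemmas cblinfun_compose_linear = cblinfun_compose_linear_left cblinfun_compose_linear_right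

lemma cblinfun_compose_id_right [simp]: "A o\<^sub>C id_cblinfun = A"
  by (rule cblinfun_eqI) simp

lemma cblinfun_compose_id_left [simp]: "id_cblinfun o\<^sub>C A = A"
  by (rule cblinfun_eqI) simp

lemma cblinfun_compose_assoc: "(A o\<^sub>C B) o\<^sub>C C = A o\<^sub>C (B o\<^sub>C C)"
  by (rule cblinfun_eqI) simp

text \<open>Douglas' lemma in the form \<open>G = W* D\<close>, written without \<open>adj\<close>
  because it is the source of the existence of adjoints. For fixed \<open>z\<close> the functional
  \<open>x \<mapsto> <G x, z>\<close> is dominated by \<open>norm (D x)\<close>, so it has a
  representing vector; choosing that vector in the closure of \<open>ran D\<close> makes it unique,
  hence linear in \<open>z\<close>.\<close>

lemma cblinfun_factor:
  fixes D :: "'a::complex_inner \<Rightarrow>\<^sub>C\<^sub>L 'b::chilbert_space" and G :: "'a \<Rightarrow>\<^sub>C\<^sub>L 'c::complex_inner"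
  assumes dom: "\<And>x. norm (G *\<^sub>V x) \<le> k * norm (D *\<^sub>V x)" and k: "0 \<le> k"
  shows "\<exists>W :: 'c \<Rightarrow>\<^sub>C\<^sub>L 'b. norm W \<le> k \<and>
    (\<forall>x z. cinner (G *\<^sub>V x) z = cinner (D *\<^sub>V x) (W *\<^sub>V z))"
proof -
  define M where "M = closure (range (cblinfun_apply D))"
  have lim_M: "\<exists>X. (\<lambda>n. D *\<^sub>V X n) \<longlonglongrightarrow> m" if "m \<in> M" for m
  proof -
    obtain Y where Y: "\<forall>n. Y n \<in> range (cblinfun_apply D)" "Y \<longlonglongrightarrow> m"
      using \<open>m \<in> M\<close> unfolding M_def closure_sequential by blast
    then have "\<forall>n. \<exists>x. Y n = D *\<^sub>V x" by (simp add: image_iff)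
    from choice[OF this] obtain X where "\<forall>n. Y n = D *\<^sub>V X n" by blast
    then have "Y = (\<lambda>n. D *\<^sub>V X n)" by (simp add: fun_eq_iff)
    then show ?thesis using Y(2) by (intro exI[of _ X]) simp
  qed
  \<comment> \<open>The difference \<open>y - y'\<close> is orthogonal to \<open>ran D\<close> and
    also a limit of vectors of \<open>ran D\<close>.\<close>
  have unique: "y = y'" if "y \<in> M" "y' \<in> M" "\<And>x. inner (D *\<^sub>V x) y = inner (D *\<^sub>V x) y'" for y y'
  proof -
    obtain X where "(\<lambda>n. D *\<^sub>V X n) \<longlonglongrightarrow> y" using lim_M[OF \<open>y \<in> M\<close>] by blast
    moreover obtain X' where "(\<lambda>n. D *\<^sub>V X' n) \<longlonglongrightarrow> y'"
      using lim_M[OF \<open>y' \<in> M\<close>] by blast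
    ultimately have "(\<lambda>n. D *\<^sub>V (X n - X' n)) \<longlonglongrightarrow> y - y'"
      by (simp add: tendsto_diff)
    then have "(\<lambda>n. inner (D *\<^sub>V (X n - X' n)) (y - y')) \<longlonglongrightarrow> inner (y - y') (y - y')"
      by (rule tendsto_inner) simp
    moreover have "(\<lambda>n. inner (D *\<^sub>V (X n - X' n)) (y - y')) = (\<lambda>n. 0)"
      unfolding inner_diff_right that(3) by simp
    ultimately have "inner (y - y') (y - y') = 0" 
      using LIMSEQ_unique[OF _ tendsto_const] by (simp only:)
    then show ?thesis by simp
  qed
  have M_add: "y + y' \<in> M" if "y \<in> M" "y' \<in> M" for y y'
  proof -
    obtain X where "(\<lambda>n. D *\<^sub>V X n) \<longlonglongrightarrow> y" using lim_M[OF \<open>y \<in> M\<close>] by blast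
    moreover obtain X' where "(\<lambda>n. D *\<^sub>V X' n) \<longlonglongrightarrow> y'"
      using lim_M[OF \<open>y' \<in> M\<close>] by blast
    ultimately have "(\<lambda>n. D *\<^sub>V (X n + X' n)) \<longlonglongrightarrow> y + y'"
      by (simp add: tendsto_add)
    then show ?thesis unfolding M_def closure_sequential
      by (intro exI[of _ "\<lambda>n. D *\<^sub>V (X n + X' n)"]) (simp del: cblinfun_apply_linear)
  qed
  have M_scaleC: "a *\<^sub>C y \<in> M" if "y \<in> M" for a y
  proof -
    obtain X where "(\<lambda>n. D *\<^sub>V X n) \<longlonglongrightarrow> y" using lim_M[OF \<open>y \<in> M\<close>] by blast
    then have "(\<lambda>n. D *\<^sub>V (a *\<^sub>C X n)) \<longlonglongrightarrow> a *\<^sub>C y"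
      using bounded_linear.tendsto[OF bounded_linear_scaleC_right] by simp
    then show ?thesis unfolding M_def closure_sequential
      by (intro exI[of _ "\<lambda>n. D *\<^sub>V (a *\<^sub>C X n)"]) (simp del: cblinfun_apply_scaleC)
  qed
  have "\<exists>y\<in>M. norm y \<le> k * norm z \<and> (\<forall>x. inner (G *\<^sub>V x) z = inner (D *\<^sub>V x) y)" for z
    unfolding M_def
  proof (rule riesz_variational[OF linear_cblinfun_apply])
    show "linear (\<lambda>x. inner (G *\<^sub>V x) z)"
      by (rule linearI) (simp_all add: inner_add_left)
    fix x
    have "\<bar>inner (G *\<^sub>V x) z\<bar> \<le> norm (G *\<^sub>V x) * norm z" by (rule Cauchy_Schwarz_ineq2)
    also have "\<dots> \<le> k * norm (D *\<^sub>V x) * norm z" by (intro mult_right_mono dom) simp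
    finally show "\<bar>inner (G *\<^sub>V x) z\<bar> \<le> k * norm z * norm (D *\<^sub>V x)"
      by (simp add: mult.assoc mult.commute[of "norm z"])
  qed (use k in simp)
  then obtain f where fM: "\<And>z. f z \<in> M" and f_norm: "\<And>z. norm (f z) \<le> k * norm z"
    and f_inner: "\<And>x z. inner (G *\<^sub>V x) z = inner (D *\<^sub>V x) (f z)"
    by metis
  have f_cinner: "cinner (G *\<^sub>V x) z = cinner (D *\<^sub>V x) (f z)" for x z
  proof (rule complex_eqI)
    show "Re (cinner (G *\<^sub>V x) z) = Re (cinner (D *\<^sub>V x) (f z))"
      by (simp only: inner_cinner[symmetric] f_inner)
    \<comment> \<open>The imaginary part is the real identity evaluated at
      \<open>\<i> x\<close>.\<close>
    show "Im (cinner (G *\<^sub>V x) z) = Im (cinner (D *\<^sub>V x) (f z))"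
      using f_inner[of "\<i> *\<^sub>C x" z] by (simp add: inner_cinner cinner_scaleC_left)
  qed
  have f_add: "f (z + z') = f z + f z'" for z z'
    by (rule unique[OF fM M_add[OF fM fM]]) (simp add: f_inner[symmetric] inner_add_right)
  have f_scaleC: "f (a *\<^sub>C z) = a *\<^sub>C f z" for a z
    by (rule unique[OF fM M_scaleC[OF fM]])
      (simp add: inner_cinner f_cinner[symmetric] cinner_scaleC_right)
  have "bounded_linear f"
  proof (rule bounded_linear_intro)
    show "f (r *\<^sub>R z) = r *\<^sub>R f z" for r z
      using f_scaleC[of "of_real r" z] by (simp add: scaleC_of_real)
    show "norm (f z) \<le> norm z * k" for z using f_norm[of z] by (simp add: mult.commute)
  qed (rule f_add)
  then have W: "Cblinfun f *\<^sub>V z = f z" for z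
    using f_scaleC by (simp add: Cblinfun_inverse)
  have "norm (Cblinfun f) \<le> k"
    by (rule norm_cblinfun_le) (simp_all add: W f_norm k)
  then show ?thesis using W f_cinner by metis
qed

text \<open>Factoring \<open>A\<close> through the identity gives a candidate; as the inner product
  separates points it is the only one, so the description defining \<open>adj\<close> denotes
  it.\<close>

lemma cinner_adj:
  fixes A :: "'a::chilbert_space \<Rightarrow>\<^sub>C\<^sub>L 'b::chilbert_space"
  shows "cinner (A *\<^sub>V x) y = cinner x (adj A *\<^sub>V y)"
proof -
  obtain W :: "'b \<Rightarrow>\<^sub>C\<^sub>L 'a" where W: "\<And>x y. cinner (A *\<^sub>V x) y = cinner x (W *\<^sub>V y)"
    using cblinfun_factor[of A "norm A" id_cblinfun] norm_cblinfun_apply_le[of A] by auto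
  have "adj A = W"
    unfolding adj_def
  proof (rule the_equality)
    fix B assume "\<forall>x y. cinner (A *\<^sub>V x) y = cinner x (B *\<^sub>V y)"
    then have B: "cinner x (B *\<^sub>V y) = cinner (A *\<^sub>V x) y" for x y
      by (metis (no_types))
    show "B = W"
      by (rule cblinfun_eqI, rule cinner_Re_ext) (simp only: B W)
  qed (intro allI W)
  then show ?thesis by (simp only: W)
qed

lemma cinner_adj_left: "cinner (adj A *\<^sub>V x) y = cinner x (A *\<^sub>V y)"
  using cinner_commute[of "adj A *\<^sub>V x" y] cinner_commute[of x "A *\<^sub>V y"]
  by (simp only: cinner_adj)

lemma adj_eqI:
  assumes "\<And>x y. cinner (A *\<^sub>V x) y = cinner x (B *\<^sub>V y)"
  shows "adj A = B"
  by (rule cblinfun_eqI, rule cinner_Re_ext) (simp add: assms[symmetric] cinner_adj)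

section \<open>Selfadjoint operators and their quadratic forms\<close>

lemma selfadjoint_iff: "selfadjoint A \<longleftrightarrow> (\<forall>x y. cinner (A *\<^sub>V x) y = cinner x (A *\<^sub>V y))"
proof
  show "\<forall>x y. cinner (A *\<^sub>V x) y = cinner x (A *\<^sub>V y)" if "selfadjoint A"
    using cinner_adj[of A] that by (simp add: selfadjoint_def)
qed (simp add: selfadjoint_def adj_eqI)

lemma norm_adj_le: "norm (adj A) \<le> norm A"
proof (rule norm_cblinfun_le)
  fix y
  have "(norm (adj A *\<^sub>V y))\<^sup>2 = inner (A *\<^sub>V (adj A *\<^sub>V y)) y"
    by (simp add: norm_eq_Re_cinner inner_cinner cinner_adj)
  also have "\<dots> \<le> norm A * norm (adj A *\<^sub>V y) * norm y"
    using norm_cauchy_schwarz norm_cblinfun_apply_le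
    by (meson mult_right_mono norm_ge_zero order_trans)
  finally show "norm (adj A *\<^sub>V y) \<le> norm A * norm y"
    by (cases "norm (adj A *\<^sub>V y) = 0") (simp_all add: power2_eq_square mult_ac mult_le_cancel_left)
qed simp

lemma selfadjoint_cinner_real: "selfadjoint A \<Longrightarrow> Im (cinner (A *\<^sub>V x) x) = 0"
  using arg_cong[OF cinner_commute[of "A *\<^sub>V x" x], of Im] by (simp add: selfadjoint_iff)

text \<open>Polarisation: the form at \<open>x + y\<close> links the imaginary parts of the two
  mixed terms, and replacing \<open>x\<close> by \<open>\<i> x\<close> links their real parts. This
  is where complex scalars enter.\<close>

lemma selfadjointI:
  assumes "\<And>x. Im (cinner (A *\<^sub>V x) x) = 0"
  shows "selfadjoint A"
  unfolding selfadjoint_iff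
proof (intro allI)
  fix x y
  have 1: "Im (cinner (A *\<^sub>V x) y) + Im (cinner (A *\<^sub>V y) x) = 0" for x y
    using assms[of "x + y"] assms[of x] assms[of y] by (simp add: cinner_simps)
  have 2: "Re (cinner (A *\<^sub>V x) y) = Re (cinner (A *\<^sub>V y) x)"
    using 1[of "\<i> *\<^sub>C x" y] by (simp add: cinner_simps)
  show "cinner (A *\<^sub>V x) y = cinner x (A *\<^sub>V y)"
    by (subst cinner_commute[of x]) (use 1[of x y] 2 in \<open>auto intro: complex_eqI\<close>)
qed

lemma nonneg_op_selfadjoint: "nonneg_op A \<Longrightarrow> selfadjoint A"
  unfolding nonneg_op_def by (simp add: selfadjointI)

lemma nonneg_op_iff: "nonneg_op A \<longleftrightarrow> selfadjoint A \<and> (\<forall>x. 0 \<le> inner (A *\<^sub>V x) x)"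
  using nonneg_op_selfadjoint selfadjoint_cinner_real unfolding nonneg_op_def inner_cinner by blast

lemma selfadjoint_inner: "selfadjoint A \<Longrightarrow> inner (A *\<^sub>V x) y = inner x (A *\<^sub>V y)"
  by (simp add: selfadjoint_iff inner_cinner)

lemma selfadjoint_diag_eq:
  assumes "selfadjoint A" "selfadjoint B" "\<And>x. inner (A *\<^sub>V x) x = inner (B *\<^sub>V x) x"
  shows "A = B"
proof (rule cblinfun_eqI, rule cinner_Re_ext)
  fix x z
  have "inner (A *\<^sub>V z) x = inner (B *\<^sub>V z) x"
    using assms(3)[of "z + x"] assms(3)[of z] assms(3)[of x] selfadjoint_inner[OF assms(1), of z x]
      selfadjoint_inner[OF assms(2), of z x]
    by (simp add: inner_add_left inner_add_right inner_commute)
  then show "Re (cinner z (A *\<^sub>V x)) = Re (cinner z (B *\<^sub>V x))"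
    using assms by (simp add: inner_cinner selfadjoint_iff)
qed

text \<open>The form controls the norm through polarisation at \<open>t x\<close> and
  \<open>A x\<close>, followed by the parallelogram law.\<close>

lemma selfadjoint_norm_le:
  assumes A: "selfadjoint A" and k: "0 \<le> k" and bound: "\<And>x. \<bar>inner (A *\<^sub>V x) x\<bar> \<le> k * (norm x)\<^sup>2"
  shows "norm A \<le> k"
proof (rule norm_cblinfun_le)
  fix x
  show "norm (A *\<^sub>V x) \<le> k * norm x"
  proof (cases "A *\<^sub>V x = 0 \<or> x = 0")
    case False
    \<comment> \<open>This scaling gives \<open>t x\<close> and \<open>A x\<close> equal length, so
      that no constant is lost in the parallelogram law.\<close>
    define t where "t = norm (A *\<^sub>V x) / norm x"
    have t: "t > 0" and tx: "norm (A *\<^sub>V x) = t * norm x" using False by (auto simp: t_def)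
    define y where "y = A *\<^sub>V x"
    have "4 * t * inner (A *\<^sub>V x) y = inner (A *\<^sub>V (t *\<^sub>R x + y)) (t *\<^sub>R x + y)
        - inner (A *\<^sub>V (t *\<^sub>R x - y)) (t *\<^sub>R x - y)"
      using selfadjoint_inner[OF A, of x y] selfadjoint_inner[OF A, of y x]
      by (simp add: inner_simps inner_commute algebra_simps)
    also have "\<dots> \<le> k * (norm (t *\<^sub>R x + y))\<^sup>2 + k * (norm (t *\<^sub>R x - y))\<^sup>2"
      using bound[of "t *\<^sub>R x + y"] bound[of "t *\<^sub>R x - y"] by linarith
    also have "\<dots> = 2 * k * (t\<^sup>2 * (norm x)\<^sup>2 + (norm y)\<^sup>2)"
      unfolding power2_norm_eq_inner
      by (simp add: inner_simps inner_commute algebra_simps power2_eq_square)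
    finally have "4 * t * (t * norm x)\<^sup>2 \<le> 4 * k * (t * norm x)\<^sup>2"
      unfolding y_def tx[symmetric] by (simp add: power2_norm_eq_inner[symmetric] tx power_mult_distrib)
    then have "t \<le> k" using t False by (simp add: mult_le_cancel_right)
    then show ?thesis unfolding tx by (simp add: mult_right_mono)
  qed (use k in auto)
qed (rule k)

section \<open>Continuity of evaluation and composition, and completeness of the operator
  space\<close>

lemma cblinfun_compose_zero_right [simp]: "A o\<^sub>C 0 = 0"
  by (rule cblinfun_eqI) simp

lemma cblinfun_compose_zero_left [simp]: "0 o\<^sub>C A = 0"
  by (rule cblinfun_eqI) simp

lemma bounded_linear_cblinfun_eval: "bounded_linear (\<lambda>A. A *\<^sub>V x)"
  by (rule bounded_linear_intro[where K = "norm x"]) (simp_all add: norm_cblinfun_apply_le)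

lemma bounded_bilinear_cblinfun_compose: "bounded_bilinear (o\<^sub>C)"
  by unfold_locales
    (auto simp: cblinfun_compose_linear intro!: exI[of _ 1] norm_cblinfun_compose_le)

lemma Cauchy_cblinfun_convergent:
  fixes X :: "nat \<Rightarrow> 'a::complex_inner \<Rightarrow>\<^sub>C\<^sub>L 'b::chilbert_space"
  assumes "Cauchy X"
  shows "convergent X"
proof -
  have "Cauchy (\<lambda>n. X n *\<^sub>V x)" for x
    by (rule bounded_linear.Cauchy[OF bounded_linear_cblinfun_eval assms])
  then have "\<forall>x. \<exists>y. (\<lambda>n. X n *\<^sub>V x) \<longlonglongrightarrow> y"
    by (simp add: Cauchy_convergent_iff convergent_def)
  from choice[OF this] obtain f where f: "\<And>x. (\<lambda>n. X n *\<^sub>V x) \<longlonglongrightarrow> f x" by blast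
  \<comment> \<open>The Cauchy estimate is uniform over \<open>x\<close> relative to
    \<open>norm x\<close>, and letting \<open>m\<close> grow transfers it to the pointwise limit
    \<open>f\<close>. This yields both boundedness of \<open>f\<close> and convergence in
    norm.\<close>
  have tail: "\<exists>N. \<forall>n\<ge>N. \<forall>x. norm (X n *\<^sub>V x - f x) \<le> e * norm x" if "0 < e" for e
  proof -
    obtain N where N: "\<And>m n. m \<ge> N \<Longrightarrow> n \<ge> N \<Longrightarrow> norm (X n - X m) < e"
      using assms \<open>0 < e\<close> unfolding Cauchy_def dist_norm by blast
    have "norm (X n *\<^sub>V x - f x) \<le> e * norm x" if "n \<ge> N" for n x
    proof (rule Lim_bounded)
      show "(\<lambda>m. norm (X n *\<^sub>V x - X m *\<^sub>V x)) \<longlonglongrightarrow> norm (X n *\<^sub>V x - f x)"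
        by (intro tendsto_intros f)
      show "\<forall>m\<ge>N. norm (X n *\<^sub>V x - X m *\<^sub>V x) \<le> e * norm x"
      proof (intro allI impI)
        fix m assume "m \<ge> N"
        then have "norm (X n - X m) * norm x \<le> e * norm x"
          using N[of m n] that by (intro mult_right_mono) auto
        then show "norm (X n *\<^sub>V x - X m *\<^sub>V x) \<le> e * norm x"
          using norm_cblinfun_apply_le[of "X n - X m" x] by simp
      qed
    qed
    then show ?thesis by blast
  qed
  have f_add: "f (x + y) = f x + f y" for x y
    using LIMSEQ_unique[OF f[of "x + y"]] tendsto_add[OF f[of x] f[of y]] by simp
  have f_scaleC: "f (a *\<^sub>C x) = a *\<^sub>C f x" for a x
    using LIMSEQ_unique[OF f[of "a *\<^sub>C x"]]
      bounded_linear.tendsto[OF bounded_linear_scaleC_right f[of x]] by simp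
  obtain N where N: "\<And>x. norm (X N *\<^sub>V x - f x) \<le> norm x"
    using tail[of 1] by auto
  have "bounded_linear f"
  proof (rule bounded_linear_intro)
    show "f (r *\<^sub>R x) = r *\<^sub>R f x" for r x
      using f_scaleC[of "of_real r" x] by (simp add: scaleC_of_real)
    show "norm (f x) \<le> norm x * (norm (X N) + 1)" for x
      using N[of x] norm_cblinfun_apply_le[of "X N" x] norm_triangle_ineq4[of "X N *\<^sub>V x" "X N *\<^sub>V x - f x"]
      by (simp add: algebra_simps)
  qed (rule f_add)
  then have L: "Cblinfun f *\<^sub>V x = f x" for x
    using f_scaleC by (simp add: Cblinfun_inverse)
  have "X \<longlonglongrightarrow> Cblinfun f"
  proof (rule LIMSEQ_I)
    fix e :: real assume "0 < e"
    then obtain N where N: "\<And>n x. n \<ge> N \<Longrightarrow> norm (X n *\<^sub>V x - f x) \<le> (e / 2) * norm x"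
      using tail[of "e / 2"] by auto
    have "norm (X n - Cblinfun f) \<le> e / 2" if "n \<ge> N" for n
      using N[OF that] \<open>0 < e\<close> by (intro norm_cblinfun_le) (simp_all add: L)
    then show "\<exists>N. \<forall>n\<ge>N. norm (X n - Cblinfun f) < e"
      using \<open>0 < e\<close> by (intro exI[of _ N]) fastforce
  qed
  then show ?thesis by (rule convergentI)
qed

section \<open>Stability of selfadjointness and estimates for forms\<close>

lemma selfadjoint_id: "selfadjoint id_cblinfun"
  by (simp add: selfadjoint_iff)

lemma selfadjoint_zero: "selfadjoint 0"
  by (simp add: selfadjoint_iff)

lemma selfadjoint_add: "selfadjoint A \<Longrightarrow> selfadjoint B \<Longrightarrow> selfadjoint (A + B)"
  by (simp add: selfadjoint_iff cinner_simps)

lemma selfadjoint_diff: "selfadjoint A \<Longrightarrow> selfadjoint B \<Longrightarrow> selfadjoint (A - B)"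
  by (simp add: selfadjoint_iff cinner_simps)

lemma selfadjoint_scaleR: "selfadjoint A \<Longrightarrow> selfadjoint (r *\<^sub>R A)"
  by (simp add: selfadjoint_iff cinner_simps)

lemma selfadjoint_adj_compose: "selfadjoint (adj A o\<^sub>C A)"
  by (simp add: selfadjoint_iff cinner_adj[symmetric] cinner_adj_left)

lemma selfadjoint_compose_adj: "selfadjoint (A o\<^sub>C adj A)"
  by (rule selfadjointI) (simp add: cinner_adj[of A] cinner_self)

lemma selfadjoint_square: "selfadjoint A \<Longrightarrow> selfadjoint (A o\<^sub>C A)"
  using selfadjoint_adj_compose[of A] by (simp add: selfadjoint_def)

lemma inner_square: "selfadjoint A \<Longrightarrow> inner ((A o\<^sub>C A) *\<^sub>V x) x = (norm (A *\<^sub>V x))\<^sup>2"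
  using selfadjoint_inner[of A "A *\<^sub>V x" x] by (simp add: power2_norm_eq_inner)

lemma abs_inner_cblinfun_le: "\<bar>inner (A *\<^sub>V x) x\<bar> \<le> norm A * (norm x)\<^sup>2"
proof -
  have "\<bar>inner (A *\<^sub>V x) x\<bar> \<le> norm (A *\<^sub>V x) * norm x" by (rule Cauchy_Schwarz_ineq2)
  also have "\<dots> \<le> norm A * norm x * norm x"
    by (intro mult_right_mono norm_cblinfun_apply_le) simp
  finally show ?thesis by (simp add: power2_eq_square mult.assoc)
qed

section \<open>Square roots of nonnegative operators\<close>

text \<open>Approximations to \<open>1 - S\<close>, where \<open>S\<close> is the square root of
  \<open>1 - B\<close>.\<close>

primrec sqrt_iter :: "('a::complex_inner \<Rightarrow>\<^sub>C\<^sub>L 'a) \<Rightarrow> nat \<Rightarrow> 'a \<Rightarrow>\<^sub>C\<^sub>L 'a" where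
  "sqrt_iter B 0 = 0"
| "sqrt_iter B (Suc n) = (1/2) *\<^sub>R (B + sqrt_iter B n o\<^sub>C sqrt_iter B n)"

text \<open>The same recursion for the scalar \<open>B = 1\<close>, serving as a majorant.\<close>

primrec sqrt_bound :: "nat \<Rightarrow> real" where
  "sqrt_bound 0 = 0"
| "sqrt_bound (Suc n) = (1 + (sqrt_bound n)\<^sup>2) / 2"

lemma sqrt_bound_range: "0 \<le> sqrt_bound n \<and> sqrt_bound n \<le> 1"
proof (induction n)
  case (Suc n)
  then have "(sqrt_bound n)\<^sup>2 \<le> 1" by (simp add: power_le_one)
  then show ?case by simp
qed simp

text \<open>The increment from \<open>s\<close> is \<open>(1 - s)^2 / 2\<close>, so the sequence
  increases, and it is bounded by 1.\<close>

lemma Cauchy_sqrt_bound: "Cauchy sqrt_bound"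
proof -
  have "sqrt_bound n \<le> sqrt_bound (Suc n)" for n
  proof -
    have "0 \<le> (1 - sqrt_bound n)\<^sup>2" by simp
    then show ?thesis by (simp add: power2_diff)
  qed
  then have "incseq sqrt_bound" by (rule incseq_SucI)
  then show ?thesis
    using incseq_convergent[of sqrt_bound 1] sqrt_bound_range
    by (metis convergent_Cauchy convergentI)
qed

lemma norm_sqrt_iter:
  assumes "norm B \<le> 1"
  shows "norm (sqrt_iter B n) \<le> sqrt_bound n"
proof (induction n)
  case (Suc n)
  have "norm (sqrt_iter B n o\<^sub>C sqrt_iter B n) \<le> (sqrt_bound n)\<^sup>2"
    using norm_cblinfun_compose_le mult_mono[OF Suc Suc] sqrt_bound_range[of n]
    by (metis norm_ge_zero order_trans power2_eq_square)
  then show ?case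
    using norm_triangle_ineq[of B "sqrt_iter B n o\<^sub>C sqrt_iter B n"] assms by simp
qed simp

lemma norm_sqrt_iter_step:
  assumes "norm B \<le> 1"
  shows "norm (sqrt_iter B (Suc n) - sqrt_iter B n) \<le> sqrt_bound (Suc n) - sqrt_bound n"
proof (induction n)
  case (Suc n)
  let ?X = "sqrt_iter B (Suc n)" and ?Y = "sqrt_iter B n"
  let ?x = "sqrt_bound (Suc n)" and ?y = "sqrt_bound n"
  \<comment> \<open>The difference of squares is split as \<open>X (X - Y) + (X - Y) Y\<close>,
    which needs no commutativity. The scalar increments obey the same recursion exactly.\<close>
  have "(1/2) *\<^sub>R (B + X o\<^sub>C X) - (1/2) *\<^sub>R (B + Y o\<^sub>C Y)
      = (1/2) *\<^sub>R (X o\<^sub>C (X - Y) + (X - Y) o\<^sub>C Y)" for X Y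
    by (simp add: cblinfun_compose_linear algebra_simps)
  from this[of ?X ?Y]
  have "sqrt_iter B (Suc (Suc n)) - ?X = (1/2) *\<^sub>R (?X o\<^sub>C (?X - ?Y) + (?X - ?Y) o\<^sub>C ?Y)"
    by (simp only: sqrt_iter.simps(2)[of B "Suc n", symmetric] sqrt_iter.simps(2)[of B n, symmetric])
  then have "norm (sqrt_iter B (Suc (Suc n)) - ?X) \<le>
      (norm (?X o\<^sub>C (?X - ?Y)) + norm ((?X - ?Y) o\<^sub>C ?Y)) / 2"
    using norm_triangle_ineq[of "?X o\<^sub>C (?X - ?Y)" "(?X - ?Y) o\<^sub>C ?Y"] by (simp del: sqrt_iter.simps)
  also have "\<dots> \<le> (?x * (?x - ?y) + (?x - ?y) * ?y) / 2"
  proof -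
    have 1: "norm (?X o\<^sub>C (?X - ?Y)) \<le> ?x * (?x - ?y)"
      by (rule order_trans[OF norm_cblinfun_compose_le mult_mono[OF norm_sqrt_iter[OF assms] Suc]])
        (use sqrt_bound_range in \<open>simp_all del: sqrt_bound.simps\<close>)
    have 2: "norm ((?X - ?Y) o\<^sub>C ?Y) \<le> (?x - ?y) * ?y"
      by (rule order_trans[OF norm_cblinfun_compose_le mult_mono[OF Suc norm_sqrt_iter[OF assms]]])
        (use order_trans[OF norm_ge_zero Suc] in \<open>simp_all del: sqrt_bound.simps sqrt_iter.simps\<close>)
    show ?thesis by (rule divide_right_mono[OF add_mono[OF 1 2]]) simp
  qed
  also have "\<dots> = sqrt_bound (Suc (Suc n)) - ?x"
    unfolding sqrt_bound.simps(2)[of "Suc n"]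
    by (simp add: field_simps power2_eq_square)
  finally show ?case .
qed (use assms in simp)

lemma norm_sqrt_iter_diff:
  assumes "norm B \<le> 1" "n \<le> m"
  shows "norm (sqrt_iter B m - sqrt_iter B n) \<le> sqrt_bound m - sqrt_bound n"
  using assms(2)
proof (induction m rule: dec_induct)
  case (step m)
  have "norm (sqrt_iter B (Suc m) - sqrt_iter B n) \<le>
      norm (sqrt_iter B (Suc m) - sqrt_iter B m) + norm (sqrt_iter B m - sqrt_iter B n)"
    using norm_triangle_ineq[of "sqrt_iter B (Suc m) - sqrt_iter B m" "sqrt_iter B m - sqrt_iter B n"]
    by (simp del: sqrt_iter.simps)
  then show ?case using norm_sqrt_iter_step[OF assms(1), of m] step.IH by linarith
qed simp

lemma Cauchy_sqrt_iter:
  assumes "norm B \<le> 1"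
  shows "Cauchy (sqrt_iter B)"
proof (rule metric_CauchyI)
  fix e :: real assume "0 < e"
  then obtain M where M: "\<And>m n. m \<ge> M \<Longrightarrow> n \<ge> M \<Longrightarrow> dist (sqrt_bound m) (sqrt_bound n) < e"
    using Cauchy_sqrt_bound unfolding Cauchy_def by blast
  have *: "dist (sqrt_iter B m) (sqrt_iter B n) < e" if "m \<ge> n" "n \<ge> M" for m n
    using norm_sqrt_iter_diff[OF assms that(1)] M[of m n] that by (simp add: dist_norm)
  then have "dist (sqrt_iter B m) (sqrt_iter B n) < e" if "m \<ge> M" "n \<ge> M" for m n
    using that by (metis dist_commute nle_le)
  then show "\<exists>M. \<forall>m\<ge>M. \<forall>n\<ge>M. dist (sqrt_iter B m) (sqrt_iter B n) < e" by blast
qed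

lemma selfadjoint_sqrt_iter: "selfadjoint B \<Longrightarrow> selfadjoint (sqrt_iter B n)"
  by (induction n)
    (simp_all add: selfadjoint_zero selfadjoint_scaleR selfadjoint_add selfadjoint_square)

text \<open>The iterates are polynomials in \<open>B\<close>. Their limit inherits the commutation,
  on which uniqueness of the square root rests.\<close>

lemma sqrt_iter_commute:
  assumes "C o\<^sub>C B = B o\<^sub>C C"
  shows "C o\<^sub>C sqrt_iter B n = sqrt_iter B n o\<^sub>C C"
proof (induction n)
  case 0
  show ?case by simp
next
  case (Suc n)
  have "C o\<^sub>C (sqrt_iter B n o\<^sub>C sqrt_iter B n) = (sqrt_iter B n o\<^sub>C sqrt_iter B n) o\<^sub>C C"
    using Suc by (metis cblinfun_compose_assoc)
  then show ?case using assms by (simp add: cblinfun_compose_linear)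
qed

lemma selfadjoint_limit:
  assumes X: "X \<longlonglongrightarrow> L" and sa: "\<And>n. selfadjoint (X n)"
  shows "selfadjoint L"
proof (rule selfadjointI)
  fix x
  have "(\<lambda>n. inner (X n *\<^sub>V x) (\<i> *\<^sub>C x)) \<longlonglongrightarrow> inner (L *\<^sub>V x) (\<i> *\<^sub>C x)"
    by (intro tendsto_intros bounded_linear.tendsto[OF bounded_linear_cblinfun_eval X])
  moreover have "inner (X n *\<^sub>V x) (\<i> *\<^sub>C x) = 0" for n
    using selfadjoint_cinner_real[OF sa, of n x] by (simp add: cinner_eq_inner)
  ultimately show "Im (cinner (L *\<^sub>V x) x) = 0"
    by (simp add: cinner_eq_inner LIMSEQ_const_iff)
qed

text \<open>With \<open>B = 1 - A\<close>, a fixed point \<open>L\<close> of \<open>Y \<mapsto> (B + Y\<^sup>2) / 2\<close> satisfies \<open>(1 - L)\<^sup>2 = A\<close>. The scalar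
  iteration for \<open>B = 1\<close> dominates the increments, which makes the convergence one in norm.\<close>

lemma sqrt_exists_aux:
  fixes A :: "'a::chilbert_space \<Rightarrow>\<^sub>C\<^sub>L 'a"
  assumes A: "selfadjoint A" and norm: "norm (id_cblinfun - A) \<le> 1"
  shows "\<exists>S. nonneg_op S \<and> S o\<^sub>C S = A \<and> (\<forall>C. C o\<^sub>C A = A o\<^sub>C C \<longrightarrow> C o\<^sub>C S = S o\<^sub>C C)"
proof -
  define B where "B = id_cblinfun - A"
  obtain L where L: "sqrt_iter B \<longlonglongrightarrow> L"
    using Cauchy_cblinfun_convergent[OF Cauchy_sqrt_iter[OF norm]]
    unfolding B_def convergent_def by blast
  note compose_tendsto = bounded_bilinear.tendsto[OF bounded_bilinear_cblinfun_compose]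
  have "(\<lambda>n. sqrt_iter B (Suc n)) \<longlonglongrightarrow> (1/2) *\<^sub>R (B + L o\<^sub>C L)"
    unfolding sqrt_iter.simps by (intro tendsto_intros compose_tendsto L)
  then have "L = (1/2) *\<^sub>R (B + L o\<^sub>C L)"
    using LIMSEQ_unique LIMSEQ_Suc[OF L] by blast
  then have "2 *\<^sub>R L = 2 *\<^sub>R ((1/2) *\<^sub>R (B + L o\<^sub>C L))" by (rule arg_cong)
  then have fix_L: "L + L = B + L o\<^sub>C L" by (simp add: scaleR_2)
  have sa: "selfadjoint L"
    using selfadjoint_limit[OF L] selfadjoint_sqrt_iter selfadjoint_diff[OF selfadjoint_id A]
    unfolding B_def by blast
  have norm_L: "norm L \<le> 1"
  proof (rule Lim_bounded[OF tendsto_norm[OF L]])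
    show "\<forall>n\<ge>0. norm (sqrt_iter B n) \<le> 1"
      using norm_sqrt_iter[OF norm] sqrt_bound_range unfolding B_def by (meson order_trans)
  qed
  \<comment> \<open>Selecting the nonnegative root: since \<open>L\<close> is a selfadjoint
    contraction, its form is at most that of the identity.\<close>
  have nonneg: "nonneg_op (id_cblinfun - L)"
    unfolding nonneg_op_iff
  proof (intro conjI allI)
    fix x
    have "inner (L *\<^sub>V x) x \<le> 1 * (norm x)\<^sup>2"
      using abs_inner_cblinfun_le[of L x] mult_right_mono[OF norm_L, of "(norm x)\<^sup>2"] by simp
    then show "0 \<le> inner ((id_cblinfun - L) *\<^sub>V x) x"
      by (simp add: inner_diff_left power2_norm_eq_inner)
  qed (rule selfadjoint_diff[OF selfadjoint_id sa])
  have "(id_cblinfun - L) o\<^sub>C (id_cblinfun - L) = id_cblinfun - (L + L) + L o\<^sub>C L"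
    by (simp add: cblinfun_compose_linear)
  then have square: "(id_cblinfun - L) o\<^sub>C (id_cblinfun - L) = A"
    unfolding fix_L B_def by simp
  have "C o\<^sub>C (id_cblinfun - L) = (id_cblinfun - L) o\<^sub>C C" if "C o\<^sub>C A = A o\<^sub>C C" for C
  proof -
    have "C o\<^sub>C B = B o\<^sub>C C" unfolding B_def using that by (simp add: cblinfun_compose_linear)
    then have "C o\<^sub>C sqrt_iter B n = sqrt_iter B n o\<^sub>C C" for n by (rule sqrt_iter_commute)
    moreover have "(\<lambda>n. C o\<^sub>C sqrt_iter B n) \<longlonglongrightarrow> C o\<^sub>C L" "(\<lambda>n. sqrt_iter B n o\<^sub>C C) \<longlonglongrightarrow> L o\<^sub>C C"
      by (intro compose_tendsto L tendsto_const)+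
    ultimately have "C o\<^sub>C L = L o\<^sub>C C" using LIMSEQ_unique by simp
    then show ?thesis by (simp add: cblinfun_compose_linear)
  qed
  then show ?thesis using nonneg square by blast
qed

text \<open>Dividing by \<open>norm A\<close> gives an operator between 0 and 1, whose distance from
  the identity is at most 1; the root is then rescaled by \<open>sqrt k\<close>. The zero operator
  is treated apart to allow the division.\<close>

lemma sqrt_exists:
  fixes A :: "'a::chilbert_space \<Rightarrow>\<^sub>C\<^sub>L 'a"
  assumes A: "nonneg_op A"
  shows "\<exists>S. nonneg_op S \<and> S o\<^sub>C S = A \<and> (\<forall>C. C o\<^sub>C A = A o\<^sub>C C \<longrightarrow> C o\<^sub>C S = S o\<^sub>C C)"
proof (cases "A = 0")
  case True
  then show ?thesis by (intro exI[of _ 0]) (simp add: nonneg_op_def)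
next
  case False
  define k where "k = norm A"
  have k: "k > 0" using False unfolding k_def by simp
  define A' where "A' = (1 / k) *\<^sub>R A"
  have A'A: "A = k *\<^sub>R A'" using k unfolding A'_def by simp
  have sa: "selfadjoint A'"
    unfolding A'_def by (intro selfadjoint_scaleR nonneg_op_selfadjoint A)
  have "norm (id_cblinfun - A') \<le> 1"
  proof (rule selfadjoint_norm_le[OF selfadjoint_diff[OF selfadjoint_id sa]])
    fix x
    have "0 \<le> inner (A' *\<^sub>V x) x" using A k by (simp add: A'_def nonneg_op_iff)
    moreover have "inner (A' *\<^sub>V x) x \<le> (norm x)\<^sup>2"
      using abs_inner_cblinfun_le[of A x] k by (simp add: A'_def k_def divide_le_eq mult.commute)
    ultimately show "\<bar>inner ((id_cblinfun - A') *\<^sub>V x) x\<bar> \<le> 1 * (norm x)\<^sup>2"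
      by (simp add: inner_diff_left power2_norm_eq_inner[symmetric])
  qed simp
  then obtain S where S: "nonneg_op S" "S o\<^sub>C S = A'"
    "\<And>C. C o\<^sub>C A' = A' o\<^sub>C C \<Longrightarrow> C o\<^sub>C S = S o\<^sub>C C"
    using sqrt_exists_aux[OF sa] by blast
  have "nonneg_op (sqrt k *\<^sub>R S)"
    using S(1) k by (simp add: nonneg_op_def cinner_scaleR_left)
  moreover have "(sqrt k *\<^sub>R S) o\<^sub>C (sqrt k *\<^sub>R S) = A"
    using k by (simp add: cblinfun_compose_linear S(2) A'A)
  moreover have "C o\<^sub>C (sqrt k *\<^sub>R S) = (sqrt k *\<^sub>R S) o\<^sub>C C" if "C o\<^sub>C A = A o\<^sub>C C" for C
    using S(3)[of C] that by (simp add: A'_def cblinfun_compose_linear)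
  ultimately show ?thesis by blast
qed

text \<open>With a square root \<open>S\<close> of \<open>A\<close>, the form at \<open>x\<close> is
  \<open>(norm (S x))^2\<close>.\<close>

lemma nonneg_op_kernel:
  fixes A :: "'a::chilbert_space \<Rightarrow>\<^sub>C\<^sub>L 'a"
  assumes "nonneg_op A" "inner (A *\<^sub>V x) x = 0"
  shows "A *\<^sub>V x = 0"
proof -
  obtain S where S: "nonneg_op S" "S o\<^sub>C S = A" using sqrt_exists[OF assms(1)] by blast
  have "S *\<^sub>V x = 0"
    using inner_square[OF nonneg_op_selfadjoint[OF S(1)], of x] assms(2) S(2) by simp
  then show ?thesis unfolding S(2)[symmetric] by simp
qed

text \<open>For \<open>y = (S - T) x\<close>, commutation gives \<open>(S + T) y = 0\<close>. Both
  forms at \<open>y\<close> are nonnegative and sum to zero, so \<open>S y = T y = 0\<close>, and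
  \<open>norm y\<close> vanishes because \<open>S - T\<close> is selfadjoint.\<close>

lemma sqrt_unique:
  fixes S :: "'a::chilbert_space \<Rightarrow>\<^sub>C\<^sub>L 'a"
  assumes S: "nonneg_op S" and T: "nonneg_op T" and comm: "T o\<^sub>C S = S o\<^sub>C T" and eq: "S o\<^sub>C S = T o\<^sub>C T"
  shows "S = T"
proof (rule cblinfun_eqI)
  fix x
  define y where "y = (S - T) *\<^sub>V x"
  have "(S + T) *\<^sub>V y = ((S + T) o\<^sub>C (S - T)) *\<^sub>V x" by (simp add: y_def)
  also have "(S + T) o\<^sub>C (S - T) = 0"
    by (simp add: cblinfun_compose_linear comm eq)
  finally have "S *\<^sub>V y + T *\<^sub>V y = 0" by simp
  then have "inner (S *\<^sub>V y) y + inner (T *\<^sub>V y) y = 0"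
    by (metis inner_add_left inner_zero_left)
  moreover have "0 \<le> inner (S *\<^sub>V y) y" "0 \<le> inner (T *\<^sub>V y) y"
    using S T unfolding nonneg_op_iff by blast+
  ultimately have "S *\<^sub>V y = 0" "T *\<^sub>V y = 0"
    using nonneg_op_kernel[OF S] nonneg_op_kernel[OF T] by auto
  then have "inner ((S - T) *\<^sub>V y) x = 0" by simp
  then have "inner y y = 0"
    using selfadjoint_inner[OF selfadjoint_diff[OF S[THEN nonneg_op_selfadjoint]
          T[THEN nonneg_op_selfadjoint]], of y x] by (simp only: y_def)
  then show "S *\<^sub>V x = T *\<^sub>V x" by (simp add: y_def)
qed

lemma sqrt_op:
  assumes "nonneg_op A"
  shows "nonneg_op (sqrt_op A)" "sqrt_op A o\<^sub>C sqrt_op A = A"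
proof -
  obtain S where S: "nonneg_op S" "S o\<^sub>C S = A" "\<And>C. C o\<^sub>C A = A o\<^sub>C C \<Longrightarrow> C o\<^sub>C S = S o\<^sub>C C"
    using sqrt_exists[OF assms] by blast
  have "nonneg_op (sqrt_op A) \<and> sqrt_op A o\<^sub>C sqrt_op A = A"
    unfolding sqrt_op_def
  proof (rule theI[of _ S])
    fix T assume T: "nonneg_op T \<and> T o\<^sub>C T = A"
    then have A: "A = T o\<^sub>C T" by simp
    \<comment> \<open>Any root \<open>T\<close> commutes with its own square \<open>A\<close>, hence
      with the constructed root \<open>S\<close>, so uniqueness among commuting roots
      suffices.\<close>
    have "T o\<^sub>C A = A o\<^sub>C T" unfolding A by (rule cblinfun_compose_assoc[symmetric])
    then have "T o\<^sub>C S = S o\<^sub>C T" by (rule S(3))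
    then have comm: "S o\<^sub>C T = T o\<^sub>C S" by (rule sym)
    have "T o\<^sub>C T = S o\<^sub>C S" using T S(2) by simp
    then show "T = S" by (rule sqrt_unique[OF conjunct1[OF T] S(1) comm])
  qed (use S(1,2) in simp)
  then show "nonneg_op (sqrt_op A)" "sqrt_op A o\<^sub>C sqrt_op A = A" by auto
qed

lemma norm_sqrt_op:
  assumes "nonneg_op A"
  shows "(norm (sqrt_op A *\<^sub>V x))\<^sup>2 = inner (A *\<^sub>V x) x"
  using inner_square[OF nonneg_op_selfadjoint[OF sqrt_op(1)[OF assms]], of x] sqrt_op(2)[OF assms]
  by simp

section \<open>Selfadjoint contractions with spectrum in \<open>{1, -1}\<close>\<close>

text \<open>A left inverse of \<open>N = norm A - A\<close> would bound \<open>N\<close> below by a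
  positive constant, so the form of \<open>A\<close> would stay strictly below
  \<open>norm A\<close>, contradicting the bound of the norm by the form.\<close>

lemma nonneg_op_norm_not_invertible:
  fixes A :: "'a::chilbert_space \<Rightarrow>\<^sub>C\<^sub>L 'a"
  assumes A: "nonneg_op A" "A \<noteq> 0"
  shows "\<not> invertible_op (norm A *\<^sub>R id_cblinfun - A)"
proof
  define N where "N = norm A *\<^sub>R id_cblinfun - A"
  assume "invertible_op (norm A *\<^sub>R id_cblinfun - A)"
  then obtain R where R: "R o\<^sub>C N = id_cblinfun" unfolding invertible_op_def N_def by blast
  have N_inner: "inner (N *\<^sub>V x) x = norm A * (norm x)\<^sup>2 - inner (A *\<^sub>V x) x" for x
    by (simp add: N_def inner_diff_left power2_norm_eq_inner)
  have "0 \<le> inner (N *\<^sub>V x) x" for x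
    unfolding N_inner using abs_inner_cblinfun_le[of A x] by simp
  then have N: "nonneg_op N"
    unfolding nonneg_op_iff
    using selfadjoint_diff[OF selfadjoint_scaleR[OF selfadjoint_id] nonneg_op_selfadjoint[OF A(1)]]
    unfolding N_def by blast
  define k where "k = norm (R o\<^sub>C sqrt_op N)"
  have below: "(norm x)\<^sup>2 \<le> k\<^sup>2 * inner (N *\<^sub>V x) x" for x
  proof -
    \<comment> \<open>Here \<open>x = R N x\<close>, with \<open>N\<close> split into two square
      roots.\<close>
    have "x = (R o\<^sub>C sqrt_op N) *\<^sub>V (sqrt_op N *\<^sub>V x)"
      using arg_cong[OF R, of "\<lambda>T. T *\<^sub>V x"] arg_cong[OF sqrt_op(2)[OF N], of "\<lambda>T. T *\<^sub>V x"]
      by simp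
    then have "norm x \<le> k * norm (sqrt_op N *\<^sub>V x)"
      unfolding k_def by (metis norm_cblinfun_apply_le)
    then have "(norm x)\<^sup>2 \<le> (k * norm (sqrt_op N *\<^sub>V x))\<^sup>2" by (rule power_mono) simp
    then show ?thesis by (simp add: power_mult_distrib norm_sqrt_op[OF N])
  qed
  have k: "k\<^sup>2 > 0"
  proof (rule ccontr)
    assume "\<not> 0 < k\<^sup>2"
    then have "x = 0" for x :: 'a using below[of x] by simp
    from this[of "A *\<^sub>V x" for x] have "A = 0" by (intro cblinfun_eqI) simp
    then show False using A(2) by simp
  qed
  \<comment> \<open>The maximum with 0 supplies the nonnegative constant that the norm estimate
    requires.\<close>
  have "norm A \<le> max 0 (norm A - 1 / k\<^sup>2)"
  proof (rule selfadjoint_norm_le[OF nonneg_op_selfadjoint[OF A(1)]])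
    fix x
    have "(norm x)\<^sup>2 / k\<^sup>2 \<le> norm A * (norm x)\<^sup>2 - inner (A *\<^sub>V x) x"
      using below[of x] k unfolding N_inner by (simp add: divide_le_eq mult.commute)
    then have "inner (A *\<^sub>V x) x \<le> (norm A - 1 / k\<^sup>2) * (norm x)\<^sup>2"
      by (simp add: algebra_simps)
    also have "\<dots> \<le> max 0 (norm A - 1 / k\<^sup>2) * (norm x)\<^sup>2"
      by (rule mult_right_mono) auto
    finally show "\<bar>inner (A *\<^sub>V x) x\<bar> \<le> max 0 (norm A - 1 / k\<^sup>2) * (norm x)\<^sup>2"
      using A(1) by (simp add: nonneg_op_iff)
  qed simp
  then show False using k A(2) by (simp add: max_def split: if_splits)
qed

lemma invertible_op_compose:
  assumes "invertible_op A" "invertible_op B"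
  shows "invertible_op (A o\<^sub>C B)"
proof -
  obtain A' B' where "A o\<^sub>C A' = id_cblinfun" "A' o\<^sub>C A = id_cblinfun"
    "B o\<^sub>C B' = id_cblinfun" "B' o\<^sub>C B = id_cblinfun"
    using assms unfolding invertible_op_def by blast
  then have "(A o\<^sub>C B) o\<^sub>C (B' o\<^sub>C A') = id_cblinfun \<and> (B' o\<^sub>C A') o\<^sub>C (A o\<^sub>C B) = id_cblinfun"
    by (metis cblinfun_compose_assoc cblinfun_compose_id_left)
  then show ?thesis unfolding invertible_op_def by blast
qed

text \<open>If \<open>A = 1 - C\<^sup>2\<close> were nonzero, then \<open>\<parallel>A\<parallel>\<close> would lie in its spectrum, and
  \<open>\<parallel>A\<parallel> - A = (C - \<mu>) (C + \<mu>)\<close> for some \<open>0 \<le> \<mu> < 1\<close>.\<close>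

lemma selfadjoint_involution:
  fixes C :: "'a::chilbert_space \<Rightarrow>\<^sub>C\<^sub>L 'a"
  assumes C: "selfadjoint C" "norm C \<le> 1" and spec: "op_spectrum C \<subseteq> {1, -1}"
  shows "C o\<^sub>C C = id_cblinfun"
proof (rule ccontr)
  define A where "A = id_cblinfun - C o\<^sub>C C"
  assume "C o\<^sub>C C \<noteq> id_cblinfun"
  then have "A \<noteq> 0" unfolding A_def by simp
  have sa: "selfadjoint A"
    unfolding A_def by (intro selfadjoint_diff selfadjoint_id selfadjoint_square C)
  have A_inner: "inner (A *\<^sub>V x) x = (norm x)\<^sup>2 - (norm (C *\<^sub>V x))\<^sup>2" for x
    using inner_square[OF C(1), of x] by (simp add: A_def inner_diff_left power2_norm_eq_inner)
  have "norm (C *\<^sub>V x) \<le> norm x" for x using C(2) by (simp add: norm_cblinfun_le_one_iff)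
  then have A_nonneg: "0 \<le> inner (A *\<^sub>V x) x" for x
    unfolding A_inner by (simp add: power_mono)
  then have A: "nonneg_op A" unfolding nonneg_op_iff using sa by blast
  have "norm A \<le> 1"
    by (rule selfadjoint_norm_le[OF sa]) (use A_nonneg in \<open>simp_all add: A_inner\<close>)
  define \<mu> where "\<mu> = sqrt (1 - norm A)"
  have \<mu>: "\<mu>\<^sup>2 = 1 - norm A" "0 \<le> \<mu>" "\<mu> < 1"
    using \<open>norm A \<le> 1\<close> \<open>A \<noteq> 0\<close> unfolding \<mu>_def by simp_all
  \<comment> \<open>As \<open>A\<close> is nonzero, \<open>\<mu> < 1\<close>, so both
    \<open>\<mu>\<close> and \<open>- \<mu>\<close> lie in the resolvent set of
    \<open>C\<close>.\<close>
  have "complex_of_real \<mu> \<notin> {1, -1}" "complex_of_real (- \<mu>) \<notin> {1, -1}"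
    using \<mu>(2,3) by (auto simp: complex_eq_iff)
  then have "invertible_op (C - complex_of_real \<mu> *\<^sub>C id_cblinfun)"
    "invertible_op (C - complex_of_real (- \<mu>) *\<^sub>C id_cblinfun)"
    using spec unfolding op_spectrum_def by blast+
  then have "invertible_op ((C - \<mu> *\<^sub>R id_cblinfun) o\<^sub>C (C - (- \<mu>) *\<^sub>R id_cblinfun))"
    unfolding scaleC_of_real by (rule invertible_op_compose)
  also have "(C - \<mu> *\<^sub>R id_cblinfun) o\<^sub>C (C - (- \<mu>) *\<^sub>R id_cblinfun)
      = norm A *\<^sub>R id_cblinfun - A"
  proof -
    have "norm A = 1 - \<mu> * \<mu>" using \<mu>(1) by (simp add: power2_eq_square)
    then show ?thesis
      unfolding \<open>norm A = 1 - \<mu> * \<mu>\<close>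
      by (simp add: cblinfun_compose_linear A_def algebra_simps)
  qed
  finally show False using nonneg_op_norm_not_invertible[OF A \<open>A \<noteq> 0\<close>] by blast
qed

section \<open>Description of \<open>L(Q;\<phi>)\<close>\<close>

text \<open>The minus sign comes from \<open>cinner\<close> being conjugate linear in its second
  argument: \<open><K*Q x, x>\<close> is \<open><Q x, K x>\<close>, the conjugate of
  \<open><K x, Q x>\<close>.\<close>

lemma cinner_im_adj_prod:
  "cinner (im_adj_prod K Q *\<^sub>V x) x = - of_real (Im (cinner (K *\<^sub>V x) (Q *\<^sub>V x)))"
proof -
  have "cinner (im_adj_prod K Q *\<^sub>V x) x = inverse (2 * \<i>) *
      (cinner (Q *\<^sub>V x) (K *\<^sub>V x) - cinner (K *\<^sub>V x) (Q *\<^sub>V x))"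
    by (simp only: im_adj_prod_def scaleC_cblinfun.rep_eq minus_cblinfun.rep_eq
        cblinfun_compose.rep_eq cinner_scaleC_left cinner_diff_left cinner_adj_left)
  also have "\<dots> = - of_real (Im (cinner (K *\<^sub>V x) (Q *\<^sub>V x)))"
    by (subst cinner_commute[of "Q *\<^sub>V x"]) (simp add: complex_eq_iff)
  finally show ?thesis .
qed

lemma selfadjoint_im_adj_prod: "selfadjoint (im_adj_prod K Q)"
  by (rule selfadjointI) (simp add: cinner_im_adj_prod)

lemma inner_im_adj_prod: "inner (im_adj_prod K Q *\<^sub>V x) x = - Im (cinner (K *\<^sub>V x) (Q *\<^sub>V x))"
  by (simp add: inner_cinner cinner_im_adj_prod)

lemma selfadjoint_defect_sq: "selfadjoint (defect_sq K Q \<phi>)"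
  unfolding defect_sq_def
  by (intro selfadjoint_diff selfadjoint_scaleR selfadjoint_id selfadjoint_adj_compose)

lemma inner_defect_sq:
  "inner (defect_sq K Q \<phi> *\<^sub>V x) x =
    (norm x)\<^sup>2 - (sin \<phi>)\<^sup>2 * (norm (K *\<^sub>V x))\<^sup>2 - (cos \<phi>)\<^sup>2 * (norm (Q *\<^sub>V x))\<^sup>2"
  by (simp add: defect_sq_def inner_cinner cinner_simps cinner_adj_left norm_eq_Re_cinner)

text \<open>Expanding the squares, the diagonal terms assemble to the defect form and the cross
  terms are \<open>\<plusminus> 2 sin \<phi> cos \<phi> Im <K x, Q x>\<close>, which is the form of
  \<open>sin 2\<phi> (K*Q)_I\<close> up to sign.\<close>

lemma norm_pencil:
  fixes K Q :: "'a::chilbert_space \<Rightarrow>\<^sub>C\<^sub>L 'b::chilbert_space" and \<phi> :: real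
  defines "R \<equiv> \<lambda>x. sin (2 * \<phi>) * inner (im_adj_prod K Q *\<^sub>V x) x"
  shows "(norm ((sin \<phi> *\<^sub>R K + \<i> *\<^sub>C (cos \<phi> *\<^sub>R Q)) *\<^sub>V x))\<^sup>2
      = (norm x)\<^sup>2 - inner (defect_sq K Q \<phi> *\<^sub>V x) x - R x"
    and "(norm ((sin \<phi> *\<^sub>R K - \<i> *\<^sub>C (cos \<phi> *\<^sub>R Q)) *\<^sub>V x))\<^sup>2
      = (norm x)\<^sup>2 - inner (defect_sq K Q \<phi> *\<^sub>V x) x + R x"
proof -
  define w where "w = cinner (K *\<^sub>V x) (Q *\<^sub>V x)"
  have w: "cinner (K *\<^sub>V x) (Q *\<^sub>V x) = w" "cinner (Q *\<^sub>V x) (K *\<^sub>V x) = cnj w"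
    unfolding w_def using cinner_commute by blast+
  have R: "R x = - 2 * sin \<phi> * cos \<phi> * Im w"
    by (simp add: R_def inner_im_adj_prod w sin_double)
  show "(norm ((sin \<phi> *\<^sub>R K + \<i> *\<^sub>C (cos \<phi> *\<^sub>R Q)) *\<^sub>V x))\<^sup>2
      = (norm x)\<^sup>2 - inner (defect_sq K Q \<phi> *\<^sub>V x) x - R x"
    unfolding inner_defect_sq R norm_eq_Re_cinner[where 'a = 'b]
    by (simp add: cinner_simps w power2_eq_square algebra_simps)
  show "(norm ((sin \<phi> *\<^sub>R K - \<i> *\<^sub>C (cos \<phi> *\<^sub>R Q)) *\<^sub>V x))\<^sup>2
      = (norm x)\<^sup>2 - inner (defect_sq K Q \<phi> *\<^sub>V x) x + R x"
    unfolding inner_defect_sq R norm_eq_Re_cinner[where 'a = 'b]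
    by (simp add: cinner_simps w power2_eq_square algebra_simps)
qed

lemma L_set_iff:
  "K \<in> L_set Q \<phi> \<longleftrightarrow>
    (\<forall>x. \<bar>inner ((sin (2 * \<phi>) *\<^sub>R im_adj_prod K Q) *\<^sub>V x) x\<bar> \<le> inner (defect_sq K Q \<phi> *\<^sub>V x) x)"
proof -
  have contraction: "norm A \<le> 1 \<longleftrightarrow> (\<forall>x. (norm (A *\<^sub>V x))\<^sup>2 \<le> (norm x)\<^sup>2)" for A :: "'a \<Rightarrow>\<^sub>C\<^sub>L 'b"
    unfolding norm_cblinfun_le_one_iff by (simp add: power_mono_iff)
  show ?thesis
    unfolding L_set_def mem_Collect_eq contraction norm_pencil all_conj_distrib[symmetric]
    by (rule all_cong1) auto
qed

text \<open>Douglas factorisation of the square roots of \<open>(N \<plusminus> T) / 2\<close> through that of \<open>N\<close>.\<close>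

lemma dominated_imp_factor:
  fixes N T :: "'a::chilbert_space \<Rightarrow>\<^sub>C\<^sub>L 'a"
  assumes N: "selfadjoint N" and T: "selfadjoint T"
    and dom: "\<And>x. \<bar>inner (T *\<^sub>V x) x\<bar> \<le> inner (N *\<^sub>V x) x"
  shows "nonneg_op N \<and>
    (\<exists>C. selfadjoint C \<and> norm C \<le> 1 \<and> T = sqrt_op N o\<^sub>C C o\<^sub>C sqrt_op N)"
proof
  have N_ge: "0 \<le> inner (N *\<^sub>V x) x" for x using dom[of x] by linarith
  then show nonneg: "nonneg_op N" using N by (simp add: nonneg_op_iff)
  define D where "D = sqrt_op N"
  have D: "selfadjoint D" unfolding D_def by (rule nonneg_op_selfadjoint[OF sqrt_op(1)[OF nonneg]])
  \<comment> \<open>For \<open>0 \<le> P \<le> N\<close> the square root of \<open>P\<close> equals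
    \<open>W* D\<close> with a contraction \<open>W\<close>; only the resulting identity of forms is
    kept.\<close>
  have factor: "\<exists>W :: 'a \<Rightarrow>\<^sub>C\<^sub>L 'a. norm W \<le> 1 \<and>
      (\<forall>x. (norm (adj W *\<^sub>V (D *\<^sub>V x)))\<^sup>2 = inner (P *\<^sub>V x) x)"
    if P: "nonneg_op P" and le: "\<And>x. inner (P *\<^sub>V x) x \<le> inner (N *\<^sub>V x) x" for P
  proof -
    define G where "G = sqrt_op P"
    have "norm (G *\<^sub>V x) \<le> 1 * norm (D *\<^sub>V x)" for x
      using le[of x] by (simp add: G_def D_def norm_sqrt_op[OF nonneg, symmetric]
          norm_sqrt_op[OF P, symmetric])
    then obtain W :: "'a \<Rightarrow>\<^sub>C\<^sub>L 'a" where W: "norm W \<le> 1"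
      and eq: "\<And>x z. cinner (G *\<^sub>V x) z = cinner (D *\<^sub>V x) (W *\<^sub>V z)"
      using cblinfun_factor[of G 1 D] by auto
    have "adj W *\<^sub>V (D *\<^sub>V x) = G *\<^sub>V x" for x
    proof (rule cinner_Re_ext)
      fix z
      have "cinner (adj W *\<^sub>V (D *\<^sub>V x)) z = cinner (G *\<^sub>V x) z"
        by (simp add: eq cinner_adj_left)
      then show "Re (cinner z (adj W *\<^sub>V (D *\<^sub>V x))) = Re (cinner z (G *\<^sub>V x))"
        by (subst (1 2) cinner_commute) simp
    qed
    then show ?thesis using W by (auto simp: G_def norm_sqrt_op[OF P])
  qed
  \<comment> \<open>The factor 1/2 keeps both operators between 0 and \<open>N\<close>, so both
    \<open>W\<close> and \<open>V\<close> are contractions.\<close>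
  have plus: "nonneg_op ((1/2) *\<^sub>R (N + T))" and minus: "nonneg_op ((1/2) *\<^sub>R (N - T))"
    unfolding nonneg_op_iff using dom[THEN abs_le_D1] dom[THEN abs_le_D2] N T
    by (auto intro!: selfadjoint_scaleR selfadjoint_add selfadjoint_diff
        simp: inner_add_left inner_diff_left) (smt (verit))
  have "inner (((1/2) *\<^sub>R (N + T)) *\<^sub>V x) x \<le> inner (N *\<^sub>V x) x"
    "inner (((1/2) *\<^sub>R (N - T)) *\<^sub>V x) x \<le> inner (N *\<^sub>V x) x" for x
    using dom[of x] by (auto simp: inner_add_left inner_diff_left)
  then obtain W V :: "'a \<Rightarrow>\<^sub>C\<^sub>L 'a" where norms: "norm W \<le> 1" "norm V \<le> 1"
    and W: "\<And>x. (norm (adj W *\<^sub>V (D *\<^sub>V x)))\<^sup>2 = inner (((1/2) *\<^sub>R (N + T)) *\<^sub>V x) x"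
    and V: "\<And>x. (norm (adj V *\<^sub>V (D *\<^sub>V x)))\<^sup>2 = inner (((1/2) *\<^sub>R (N - T)) *\<^sub>V x) x"
    using factor[OF plus] factor[OF minus] by blast
  \<comment> \<open>Sandwiched between two copies of \<open>D\<close>, the two terms become
    \<open>(N + T) / 2\<close> and \<open>(N - T) / 2\<close>, with difference \<open>T\<close>.
    Each term has form between 0 and \<open>(norm z)^2\<close>, whence \<open>C\<close> is a
    contraction.\<close>
  define C where "C = W o\<^sub>C adj W - V o\<^sub>C adj V"
  have C_sa: "selfadjoint C"
    unfolding C_def by (intro selfadjoint_diff selfadjoint_compose_adj)
  have C_inner: "inner (C *\<^sub>V z) z = (norm (adj W *\<^sub>V z))\<^sup>2 - (norm (adj V *\<^sub>V z))\<^sup>2" for z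
    by (simp add: C_def inner_cinner cinner_simps cinner_adj[of W] cinner_adj[of V] norm_eq_Re_cinner)
  have adj_le: "(norm (adj A *\<^sub>V z))\<^sup>2 \<le> (norm z)\<^sup>2" if "norm A \<le> 1" for A :: "'a \<Rightarrow>\<^sub>C\<^sub>L 'a" and z
    using order_trans[OF norm_adj_le that] by (simp add: norm_cblinfun_le_one_iff power_mono)
  have "norm C \<le> 1"
  proof (rule selfadjoint_norm_le[OF C_sa])
    show "\<bar>inner (C *\<^sub>V z) z\<bar> \<le> 1 * (norm z)\<^sup>2" for z
      using adj_le[OF norms(1), of z] adj_le[OF norms(2), of z]
        zero_le_power2[of "norm (adj W *\<^sub>V z)"] zero_le_power2[of "norm (adj V *\<^sub>V z)"]
      unfolding C_inner by linarith
  qed simp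
  moreover have "T = D o\<^sub>C C o\<^sub>C D"
  proof (rule selfadjoint_diag_eq[OF T])
    show "selfadjoint (D o\<^sub>C C o\<^sub>C D)"
      using D C_sa by (simp add: selfadjoint_iff)
    show "inner (T *\<^sub>V x) x = inner ((D o\<^sub>C C o\<^sub>C D) *\<^sub>V x) x" for x
      using selfadjoint_inner[OF D, of "C *\<^sub>V (D *\<^sub>V x)" x] C_inner[of "D *\<^sub>V x"] W[of x] V[of x]
      by (simp add: inner_add_left inner_diff_left field_simps)
  qed
  ultimately show "\<exists>C. selfadjoint C \<and> norm C \<le> 1 \<and> T = sqrt_op N o\<^sub>C C o\<^sub>C sqrt_op N"
    using C_sa unfolding D_def by blast
qed

lemma inner_sandwich:
  assumes "nonneg_op N"
  shows "inner ((sqrt_op N o\<^sub>C C o\<^sub>C sqrt_op N) *\<^sub>V x) x =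
    inner (C *\<^sub>V (sqrt_op N *\<^sub>V x)) (sqrt_op N *\<^sub>V x)"
  using selfadjoint_inner[OF nonneg_op_selfadjoint[OF sqrt_op(1)[OF assms]]] by simp

lemma factor_imp_dominated:
  assumes N: "nonneg_op N" and C: "norm C \<le> 1"
  shows "\<bar>inner ((sqrt_op N o\<^sub>C C o\<^sub>C sqrt_op N) *\<^sub>V x) x\<bar> \<le> inner (N *\<^sub>V x) x"
proof -
  let ?y = "sqrt_op N *\<^sub>V x"
  have "\<bar>inner (C *\<^sub>V ?y) ?y\<bar> \<le> 1 * (norm ?y)\<^sup>2"
    using abs_inner_cblinfun_le[of C ?y] mult_right_mono[OF C, of "(norm ?y)\<^sup>2"] by simp
  then show ?thesis unfolding inner_sandwich[OF N] by (simp add: norm_sqrt_op[OF N])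
qed

lemma L_set_iff_defect_factor:
  "K \<in> L_set Q \<phi> \<longleftrightarrow> nonneg_op (defect_sq K Q \<phi>) \<and> (\<exists>C. defect_factor K Q \<phi> C)"
  unfolding L_set_iff defect_factor_def defect_def
  using dominated_imp_factor[OF selfadjoint_defect_sq selfadjoint_scaleR[OF selfadjoint_im_adj_prod]]
    factor_imp_dominated[of "defect_sq K Q \<phi>"]
  by metis

section \<open>Extreme points\<close>

text \<open>Strict convexity of Hilbert balls: the squared norm of the combination falls short of
  the averaged squared norms by exactly \<open>u (1 - u) (norm (p - q))^2\<close>.\<close>

lemma convex_combination_extreme:
  fixes p q :: "'a::real_inner"
  assumes "norm p \<le> r" "norm q \<le> r" "norm ((1 - u) *\<^sub>R p + u *\<^sub>R q) = r" "0 < u" "u < 1"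
  shows "p = q"
proof -
  have "r\<^sup>2 = (1 - u) * (norm p)\<^sup>2 + u * (norm q)\<^sup>2 - u * (1 - u) * (norm (p - q))\<^sup>2"
    unfolding assms(3)[symmetric] power2_norm_eq_inner
    by (simp add: inner_simps inner_commute algebra_simps)
  moreover have "(1 - u) * (norm p)\<^sup>2 \<le> (1 - u) * r\<^sup>2" "u * (norm q)\<^sup>2 \<le> u * r\<^sup>2"
    using assms by (auto intro!: mult_left_mono power_mono)
  ultimately have "u * (1 - u) * (norm (p - q))\<^sup>2 \<le> 0" by (simp add: algebra_simps)
  then show ?thesis using assms(4,5) by (simp add: mult_le_0_iff)
qed

text \<open>The contractions \<open>sin \<phi> K \<plusminus> i cos \<phi> Q\<close> are isometric on the two kernels of \<open>(1 \<plusminus> C) D\<close>. As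
  \<open>C\<^sup>2 = 1\<close> and \<open>ran D\<close> is invariant under \<open>C\<close>, these kernels span the space.\<close>

lemma involution_imp_extreme:
  fixes K Q :: "'a::chilbert_space \<Rightarrow>\<^sub>C\<^sub>L 'b::chilbert_space"
  assumes K: "K \<in> L_set Q \<phi>" and C: "defect_factor K Q \<phi> C" "C o\<^sub>C C = id_cblinfun"
    and inv: "cblinfun_apply C ` range (cblinfun_apply (defect K Q \<phi>))
      \<subseteq> range (cblinfun_apply (defect K Q \<phi>))"
    and sin: "sin \<phi> \<noteq> 0"
  shows "K extreme_point_of L_set Q \<phi>"
  unfolding extreme_point_of_def
proof (intro conjI ballI notI K)
  fix a b assume a: "a \<in> L_set Q \<phi>" and b: "b \<in> L_set Q \<phi>" and "K \<in> open_segment a b"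
  then obtain u where "a \<noteq> b" and u: "0 < u" "u < 1" and K_eq: "K = (1 - u) *\<^sub>R a + u *\<^sub>R b"
    unfolding in_segment by blast
  define D where "D = defect K Q \<phi>"
  have nonneg: "nonneg_op (defect_sq K Q \<phi>)" using K L_set_iff_defect_factor by blast
  have R: "sin (2 * \<phi>) * inner (im_adj_prod K Q *\<^sub>V x) x = inner (C *\<^sub>V (D *\<^sub>V x)) (D *\<^sub>V x)" for x
    using inner_sandwich[OF nonneg, of C x, symmetric] C(1)
    unfolding D_def defect_def defect_factor_def by (metis inner_scaleR_left scaleR_cblinfun.rep_eq)
  have N: "inner (defect_sq K Q \<phi> *\<^sub>V x) x = inner (D *\<^sub>V x) (D *\<^sub>V x)" for x
    by (simp add: D_def defect_def norm_sqrt_op[OF nonneg, symmetric] power2_norm_eq_inner)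
  \<comment> \<open>The sign \<open>e = \<plusminus> 1\<close> treats both contractions at
    once.\<close>
  define A where "A e L = sin \<phi> *\<^sub>R L + e *\<^sub>R (\<i> *\<^sub>C (cos \<phi> *\<^sub>R Q))" for e :: real and L
  have A_le: "norm (A e L *\<^sub>V x) \<le> norm x" if "L \<in> L_set Q \<phi>" "e = 1 \<or> e = - 1" for e L x
    using that by (auto simp: L_set_def A_def norm_cblinfun_le_one_iff)
  \<comment> \<open>The eigenvalue \<open>- e\<close> makes the \<open>C\<close> term cancel the
    defect term, so \<open>A e K\<close> preserves the norm of \<open>x\<close>. Strict convexity
    identifies \<open>A e a x\<close> with \<open>A e b x\<close>; the \<open>Q\<close> parts
    coincide and \<open>sin \<phi>\<close> can be divided out.\<close>
  have agree: "a *\<^sub>V x = b *\<^sub>V x" if e: "e = 1 \<or> e = - 1" and eig: "C *\<^sub>V (D *\<^sub>V x) = - e *\<^sub>R (D *\<^sub>V x)" for e x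
  proof -
    have "(norm (A e K *\<^sub>V x))\<^sup>2 = (norm x)\<^sup>2 - inner (D *\<^sub>V x) (D *\<^sub>V x)
        - e * inner (C *\<^sub>V (D *\<^sub>V x)) (D *\<^sub>V x)"
      using e norm_pencil[of \<phi> K Q x] unfolding R N A_def by auto
    also have "\<dots> = (norm x)\<^sup>2" using e unfolding eig by auto
    finally have "norm (A e K *\<^sub>V x) = norm x" by simp
    moreover have "A e K *\<^sub>V x = (1 - u) *\<^sub>R (A e a *\<^sub>V x) + u *\<^sub>R (A e b *\<^sub>V x)"
      by (simp add: A_def K_eq algebra_simps)
    ultimately have "A e a *\<^sub>V x = A e b *\<^sub>V x"
      using convex_combination_extreme[OF A_le[OF a e] A_le[OF b e] _ u] by simp
    then show ?thesis using sin by (simp add: A_def)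
  qed
  have "a *\<^sub>V x = b *\<^sub>V x" for x
  proof -
    \<comment> \<open>Invariance of \<open>ran D\<close> lifts the involution to the domain:
      \<open>D (x + z)\<close> and \<open>D (x - z)\<close> are fixed, respectively negated, by
      \<open>C\<close>, and \<open>x\<close> is the mean of \<open>x + z\<close> and
      \<open>x - z\<close>.\<close>
    obtain z where z: "C *\<^sub>V (D *\<^sub>V x) = D *\<^sub>V z" using inv unfolding D_def by blast
    have Cz: "C *\<^sub>V (D *\<^sub>V z) = D *\<^sub>V x"
      using arg_cong[OF C(2), of "\<lambda>T. T *\<^sub>V (D *\<^sub>V x)"] by (simp add: z)
    have "a *\<^sub>V ((1/2) *\<^sub>R (x + z)) = b *\<^sub>V ((1/2) *\<^sub>R (x + z))"
      by (rule agree[of "-1"]) (simp_all add: z Cz add.commute)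
    moreover have "a *\<^sub>V ((1/2) *\<^sub>R (x - z)) = b *\<^sub>V ((1/2) *\<^sub>R (x - z))"
      by (rule agree[of 1]) (simp_all add: z Cz algebra_simps)
    moreover have "x = (1/2) *\<^sub>R (x + z) + (1/2) *\<^sub>R (x - z)"
      by (simp add: scaleR_add_right[symmetric] scaleR_2[symmetric])
    ultimately show ?thesis by (metis cblinfun_apply_linear(1))
  qed
  then show False using \<open>a \<noteq> b\<close> cblinfun_eqI by blast
qed

text \<open>The identity \<open>T = D C D\<close> fixes only the compression of \<open>C\<close> to
  the closure of \<open>ran D\<close>. In the second part, the assumed invariance of
  \<open>ran D\<close> under \<open>C\<close> links this compression to the spectrum of
  \<open>C\<close> on the whole space.\<close>

theorem proposition3p6:
  fixes Q :: "'a::chilbert_space \<Rightarrow>\<^sub>C\<^sub>L 'b::chilbert_space" and \<phi> :: real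
  assumes "separable_space (euclidean :: 'a topology)"
    and "separable_space (euclidean :: 'b topology)"
    and "1 \<le> norm Q"
    and "0 < arccos (inverse (norm Q))"
    and "\<phi> \<in> {arccos (inverse (norm Q))..pi / 2}"
  shows "(\<forall>K. K \<in> L_set Q \<phi> \<longleftrightarrow>
            nonneg_op (defect_sq K Q \<phi>) \<and> (\<exists>C. defect_factor K Q \<phi> C)) \<and>
         (\<forall>K C. closed (range (cblinfun_apply (defect K Q \<phi>))) \<longrightarrow>
            K \<in> L_set Q \<phi> \<longrightarrow> defect_factor K Q \<phi> C \<longrightarrow>
            cblinfun_apply C ` range (cblinfun_apply (defect K Q \<phi>))
              \<subseteq> range (cblinfun_apply (defect K Q \<phi>)) \<longrightarrow>
            op_spectrum C \<subseteq> {1, -1} \<longrightarrow> K \<in> L_ext Q \<phi>)"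
proof (intro conjI allI impI)
  show "K \<in> L_set Q \<phi> \<longleftrightarrow> nonneg_op (defect_sq K Q \<phi>) \<and> (\<exists>C. defect_factor K Q \<phi> C)" for K
    by (rule L_set_iff_defect_factor)
  fix K C
  assume K: "K \<in> L_set Q \<phi>" and C: "defect_factor K Q \<phi> C" and spec: "op_spectrum C \<subseteq> {1, -1}"
    and inv: "cblinfun_apply C ` range (cblinfun_apply (defect K Q \<phi>))
      \<subseteq> range (cblinfun_apply (defect K Q \<phi>))"
  \<comment> \<open>Positivity of the arccosine keeps \<open>\<phi>\<close> away from 0, where the
    two contractions would not depend on \<open>K\<close>.\<close>
  have "0 < \<phi>" "\<phi> < pi" using assms(4,5) pi_gt_zero by auto
  then have sin: "sin \<phi> \<noteq> 0" using sin_gt_zero by fastforce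
  have "C o\<^sub>C C = id_cblinfun"
    using C spec by (intro selfadjoint_involution) (auto simp: defect_factor_def)
  then show "K \<in> L_ext Q \<phi>"
    unfolding L_ext_def using involution_imp_extreme[OF K C _ inv sin] by simp
qed

end
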